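(* The safety problem for TSO games with process fairness is undecidable: there is no algorithm that, given a concurrent program $\mathcal{P}$, a set $F$ of local states and an initial TSO configuration $c_0$, decides whether the process player wins the TSO game $\mathcal{G}(\mathcal{P})$ from $(c_0)_A$ with respect to the winning condition $W_{SP}=W_S\cap W_P$.
   Context: Let $V$ be a finite data domain and $X$ a finite set of shared variables over $V$. Instructions are $\mathrm{rd}(x,d)$, $\mathrm{wr}(x,d)$ ($x\in X,d\in V$), $\mathrm{skip}$, $\mathrm{mf}$. A process is a finite labelled transition system $\langle Q,\mathrm{Instrs},\delta\rangle$; a concurrent program is a tuple $\mathcal{P}=\langle P^\iota\rangle_{\iota\in I}$, $I$ finite. A TSO configuration is $c=\langle s,b,m\rangle$ with $s(\iota)\in Q^\iota$, FIFO buffers $b(\iota)\in(X\times V)^*$ (new messages on the left, oldest on the right), memory $m:X\to V$. TSO transitions: $\mathrm{rd}(x,d)$ of process $\iota$ is enabled if the most recent message on $x$ in $b(\iota)$ is $\langle x,d\rangle$, or if $b(\iota)$ has no message on $x$ and $m(x)=d$; $\mathrm{wr}(x,d)$ prepends $\langle x,d\rangle$ to $b(\iota)$; $\mathrm{skip}$ changes only the local state; $\mathrm{mf}$ is enabled only if $b(\iota)=\varepsilon$; an update of $\iota$ removes the oldest message $\langle x,d\rangle$ from $b(\iota)$ and sets $m(x)=d$. A game $\langle C,C_A,C_B,\to\rangle$: a play is an infinite sequence of moves, or a finite one ending in a configuration with no successors; a winning condition is a set of infinite plays; player A wins an infinite play in the winning condition or a finite play ending in $C_B$; otherwise B wins;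 a configuration is winning for A if A has a strategy winning against every strategy of B. The TSO game $\mathcal{G}(\mathcal{P})$: $C_A,C_B$ are copies of the TSO configurations; the process player (A) moves $c_A\to c'_B$ along any instruction transition of any process; the update player (B) moves $c_B\to c'_A$ for every $c'$ obtained from $c$ by zero or more updates. For a set $F$ of local states, $C_F$ is the set of game configurations where some process is in a state of $F$ (with $c_0\notin C_F$); $W_S$ is the set of plays never visiting $C_F$. Process fairness: $W_P$ is the set of plays $c_0,c_1,\dots$ such that for every $\iota\in I$, if there are infinitely many $k$ with $c_k\in C_A$ at which some instruction of process $\iota$ is enabled, then there are infinitely many $k'$ with $c_{k'}\in C_A$ such that the move $c_{k'}\to c_{k'+1}$ is an instruction of process $\iota$. *)

theory Defs
  imports Main "HOL-Library.FuncSet" "HOL-Library.Nat_Bijection"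
begin

section \<open>Concurrent programs and their TSO semantics\<close>

datatype ('x, 'v) instr = Rd 'x 'v | Wr 'x 'v | Skip | Mf

record ('i, 'q, 'x, 'v) program =
  vals :: "'v set"
  vars :: "'x set"
  procs :: "'i set"
  states :: "'i \<Rightarrow> 'q set"
  trans :: "'i \<Rightarrow> ('q \<times> ('x, 'v) instr \<times> 'q) set"

definition instrs :: "('i, 'q, 'x, 'v) program \<Rightarrow> ('x, 'v) instr set" where
  "instrs P = {Rd x d | x d. x \<in> vars P \<and> d \<in> vals P}
            \<union> {Wr x d | x d. x \<in> vars P \<and> d \<in> vals P} \<union> {Skip, Mf}"

definition wf_program :: "('i, 'q, 'x, 'v) program \<Rightarrow> bool" where
  "wf_program P \<longleftrightarrow> finite (vals P) \<and> finite (vars P) \<and> finite (procs P) \<and>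
     (\<forall>i\<in>procs P. finite (states P i) \<and> trans P i \<subseteq> states P i \<times> instrs P \<times> states P i)"

text \<open>The head of a buffer list is its newest message, the last element its oldest one.\<close>

record ('i, 'q, 'x, 'v) tso_conf =
  loc :: "'i \<Rightarrow> 'q"
  buf :: "'i \<Rightarrow> ('x \<times> 'v) list"
  mem :: "'x \<Rightarrow> 'v"

definition tso_confs :: "('i, 'q, 'x, 'v) program \<Rightarrow> ('i, 'q, 'x, 'v) tso_conf set" where
  "tso_confs P = {c. loc c \<in> (\<Pi>\<^sub>E i\<in>procs P. states P i) \<and>
                     buf c \<in> (\<Pi>\<^sub>E i\<in>procs P. lists (vars P \<times> vals P)) \<and>
                     mem c \<in> vars P \<rightarrow>\<^sub>E vals P}"

text \<open>As \<open>map_of\<close> returns the first match, \<open>map_of (buf c i) x\<close> is the most recent value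
  written to \<open>x\<close> that is still in the buffer of \<open>i\<close>, and \<open>None\<close> if there is none.\<close>

inductive instr_step ::
  "('i, 'q, 'x, 'v) program \<Rightarrow> 'i \<Rightarrow> ('i, 'q, 'x, 'v) tso_conf \<Rightarrow> ('i, 'q, 'x, 'v) tso_conf \<Rightarrow> bool"
  for P i c where
  rd: "\<lbrakk>(loc c i, Rd x d, q) \<in> trans P i;
          map_of (buf c i) x = Some d \<or> map_of (buf c i) x = None \<and> mem c x = d\<rbrakk>
         \<Longrightarrow> instr_step P i c (c\<lparr>loc := (loc c)(i := q)\<rparr>)"
| wr: "(loc c i, Wr x d, q) \<in> trans P i
         \<Longrightarrow> instr_step P i c (c\<lparr>loc := (loc c)(i := q), buf := (buf c)(i := (x, d) # buf c i)\<rparr>)"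
| skip: "(loc c i, Skip, q) \<in> trans P i
         \<Longrightarrow> instr_step P i c (c\<lparr>loc := (loc c)(i := q)\<rparr>)"
| mf: "\<lbrakk>(loc c i, Mf, q) \<in> trans P i; buf c i = []\<rbrakk>
         \<Longrightarrow> instr_step P i c (c\<lparr>loc := (loc c)(i := q)\<rparr>)"

inductive update_step ::
  "('i, 'q, 'x, 'v) program \<Rightarrow> ('i, 'q, 'x, 'v) tso_conf \<Rightarrow> ('i, 'q, 'x, 'v) tso_conf \<Rightarrow> bool"
  for P c where
  "\<lbrakk>i \<in> procs P; buf c i = w @ [(x, d)]\<rbrakk>
   \<Longrightarrow> update_step P c (c\<lparr>buf := (buf c)(i := w), mem := (mem c)(x := d)\<rparr>)"


section \<open>Games\<close>

record 'c game =
  confsA :: "'c set"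
  confsB :: "'c set"
  moves :: "('c \<times> 'c) set"

definition dead :: "'c game \<Rightarrow> 'c \<Rightarrow> bool" where
  "dead G c \<longleftrightarrow> (\<nexists>c'. (c, c') \<in> moves G)"

definition finite_path :: "'c game \<Rightarrow> 'c list \<Rightarrow> bool" where
  "finite_path G h \<longleftrightarrow> h \<noteq> [] \<and> set h \<subseteq> confsA G \<union> confsB G \<and>
     successively (\<lambda>c c'. (c, c') \<in> moves G) h"

definition infinite_path :: "'c game \<Rightarrow> (nat \<Rightarrow> 'c) \<Rightarrow> bool" where
  "infinite_path G r \<longleftrightarrow> range r \<subseteq> confsA G \<union> confsB G \<and> (\<forall>k. (r k, r (Suc k)) \<in> moves G)"

datatype 'c play = Fin "'c list" | Inf "nat \<Rightarrow> 'c"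

fun is_play :: "'c game \<Rightarrow> 'c play \<Rightarrow> bool" where
  "is_play G (Fin h) \<longleftrightarrow> finite_path G h \<and> dead G (last h)"
| "is_play G (Inf r) \<longleftrightarrow> infinite_path G r"

fun starts_in :: "'c \<Rightarrow> 'c play \<Rightarrow> bool" where
  "starts_in c (Fin h) \<longleftrightarrow> hd h = c"
| "starts_in c (Inf r) \<longleftrightarrow> r 0 = c"

fun A_wins_play :: "'c game \<Rightarrow> (nat \<Rightarrow> 'c) set \<Rightarrow> 'c play \<Rightarrow> bool" where
  "A_wins_play G W (Fin h) \<longleftrightarrow> last h \<in> confsB G"
| "A_wins_play G W (Inf r) \<longleftrightarrow> r \<in> W"

text \<open>Strategies may depend on the whole history. The set \<open>S\<close> is \<open>confsA G\<close> or \<open>confsB G\<close>.\<close>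

definition strategy :: "'c game \<Rightarrow> 'c set \<Rightarrow> ('c list \<Rightarrow> 'c) \<Rightarrow> bool" where
  "strategy G S \<sigma> \<longleftrightarrow>
     (\<forall>h. finite_path G h \<and> last h \<in> S \<and> \<not> dead G (last h) \<longrightarrow> (last h, \<sigma> h) \<in> moves G)"

fun follows :: "'c set \<Rightarrow> ('c list \<Rightarrow> 'c) \<Rightarrow> 'c play \<Rightarrow> bool" where
  "follows S \<sigma> (Fin h) \<longleftrightarrow> (\<forall>k. Suc k < length h \<and> h ! k \<in> S \<longrightarrow> h ! Suc k = \<sigma> (take (Suc k) h))"
| "follows S \<sigma> (Inf r) \<longleftrightarrow> (\<forall>k. r k \<in> S \<longrightarrow> r (Suc k) = \<sigma> (map r [0..<Suc k]))"

definition A_wins_from :: "'c game \<Rightarrow> (nat \<Rightarrow> 'c) set \<Rightarrow> 'c \<Rightarrow> bool" where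
  "A_wins_from G W c \<longleftrightarrow>
     (\<exists>\<sigma>A. strategy G (confsA G) \<sigma>A \<and>
       (\<forall>\<sigma>B. strategy G (confsB G) \<sigma>B \<longrightarrow>
         (\<forall>\<pi>. is_play G \<pi> \<and> starts_in c \<pi> \<and> follows (confsA G) \<sigma>A \<pi> \<and> follows (confsB G) \<sigma>B \<pi>
              \<longrightarrow> A_wins_play G W \<pi>)))"


text \<open>Two strategies always determine a play, so the quantification over plays in
  \<open>A_wins_from\<close> is not vacuous.\<close>

lemma play_exists:
  assumes disj: "confsA G \<inter> confsB G = {}"
    and moves: "moves G \<subseteq> (confsA G \<union> confsB G) \<times> (confsA G \<union> confsB G)"
    and c: "c \<in> confsA G \<union> confsB G"
    and A: "strategy G (confsA G) \<sigma>A" and B: "strategy G (confsB G) \<sigma>B"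
  shows "\<exists>\<pi>. is_play G \<pi> \<and> starts_in c \<pi> \<and> follows (confsA G) \<sigma>A \<pi> \<and> follows (confsB G) \<sigma>B \<pi>"
proof -
  define nxt where "nxt h = (if last h \<in> confsA G then \<sigma>A h else \<sigma>B h)" for h
  define H where "H n = ((\<lambda>h. h @ [nxt h]) ^^ n) [c]" for n
  define r where "r n = last (H n)" for n
  have H_0: "H 0 = [c]" and H_Suc: "H (Suc n) = H n @ [nxt (H n)]" for n
    by (simp_all add: H_def)
  have H_map: "H n = map r [0..<Suc n]" for n
    by (induction n) (simp_all add: H_0 H_Suc r_def)
  have r_0: "r 0 = c" by (simp add: r_def H_0)
  have r_Suc: "r (Suc n) = nxt (map r [0..<Suc n])" for n
    by (simp only: H_map[symmetric]) (simp add: r_def H_Suc)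
  have r_A: "r (Suc n) = \<sigma>A (map r [0..<Suc n])" if "r n \<in> confsA G" for n
    using that unfolding r_Suc nxt_def by simp
  have r_B: "r (Suc n) = \<sigma>B (map r [0..<Suc n])" if "r n \<in> confsB G" for n
    using that disj unfolding r_Suc nxt_def by auto
  have step: "(r n, r (Suc n)) \<in> moves G"
    if "finite_path G (map r [0..<Suc n])" "\<not> dead G (r n)" for n
  proof -
    have l: "last (map r [0..<Suc n]) = r n" by simp
    have "r n \<in> confsA G \<union> confsB G" using that(1) by (auto simp: finite_path_def)
    then consider "r n \<in> confsA G" | "r n \<in> confsB G" by blast
    then show ?thesis
    proof cases
      case 1
      have "(last (map r [0..<Suc n]), \<sigma>A (map r [0..<Suc n])) \<in> moves G"
        using A that 1 l unfolding strategy_def by metis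
      then show ?thesis unfolding r_A[OF 1] l .
    next
      case 2
      have "(last (map r [0..<Suc n]), \<sigma>B (map r [0..<Suc n])) \<in> moves G"
        using B that 2 l unfolding strategy_def by metis
      then show ?thesis unfolding r_B[OF 2] l .
    qed
  qed
  have path: "finite_path G (map r [0..<Suc n])" if "\<forall>k<n. \<not> dead G (r k)" for n
    using that
  proof (induction n)
    case 0
    then show ?case using c by (simp add: finite_path_def r_0)
  next
    case (Suc n)
    then have p: "finite_path G (map r [0..<Suc n])" by simp
    with Suc.prems have "(r n, r (Suc n)) \<in> moves G" by (intro step) simp_all
    with p moves show ?case
      by (auto simp: finite_path_def successively_append_iff)
  qed
  show ?thesis
  proof (cases "\<exists>n. dead G (r n)")
    case True
    define n where "n = (LEAST n. dead G (r n))"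
    have "dead G (r n)" unfolding n_def using True by (rule LeastI_ex)
    moreover have "\<forall>k<n. \<not> dead G (r k)" unfolding n_def using not_less_Least by blast
    ultimately have "is_play G (Fin (map r [0..<Suc n]))" using path[of n] by simp
    moreover have "starts_in c (Fin (map r [0..<Suc n]))"
      by (simp add: r_0 hd_map del: upt_Suc)
    moreover have "follows (confsA G) \<sigma>A (Fin (map r [0..<Suc n]))"
      "follows (confsB G) \<sigma>B (Fin (map r [0..<Suc n]))"
      by (auto simp: take_map r_A r_B simp del: upt_Suc)
    ultimately show ?thesis by blast
  next
    case False
    then have p: "finite_path G (map r [0..<Suc n])" for n using path by blast
    have "is_play G (Inf r)"
      using p step False by (fastforce simp: infinite_path_def finite_path_def)
    moreover have "starts_in c (Inf r)" by (simp add: r_0)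
    moreover have "follows (confsA G) \<sigma>A (Inf r)" "follows (confsB G) \<sigma>B (Inf r)"
      by (auto simp: r_A r_B simp del: upt_Suc)
    ultimately show ?thesis by blast
  qed
qed


section \<open>TSO games\<close>

datatype 'c gconf = ConfA 'c | ConfB 'c

definition tso_game ::
  "('i, 'q, 'x, 'v) program \<Rightarrow> ('i, 'q, 'x, 'v) tso_conf gconf game" where
  "tso_game P =
     \<lparr>confsA = ConfA ` tso_confs P,
      confsB = ConfB ` tso_confs P,
      moves = {(ConfA c, ConfB c') | c c'.
                 c \<in> tso_confs P \<and> c' \<in> tso_confs P \<and> (\<exists>i\<in>procs P. instr_step P i c c')}
            \<union> {(ConfB c, ConfA c') | c c'.
                 c \<in> tso_confs P \<and> c' \<in> tso_confs P \<and> (update_step P)\<^sup>*\<^sup>* c c'}\<rparr>"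

definition local_states :: "('i, 'q, 'x, 'v) program \<Rightarrow> 'q set" where
  "local_states P = (\<Union>i\<in>procs P. states P i)"

definition confs_hitting ::
  "('i, 'q, 'x, 'v) program \<Rightarrow> 'q set \<Rightarrow> ('i, 'q, 'x, 'v) tso_conf gconf set" where
  "confs_hitting P F =
     {g. \<exists>c\<in>tso_confs P. (g = ConfA c \<or> g = ConfB c) \<and> (\<exists>i\<in>procs P. loc c i \<in> F)}"

definition W_S ::
  "('i, 'q, 'x, 'v) program \<Rightarrow> 'q set \<Rightarrow> (nat \<Rightarrow> ('i, 'q, 'x, 'v) tso_conf gconf) set" where
  "W_S P F = {r. infinite_path (tso_game P) r \<and> (\<forall>k. r k \<notin> confs_hitting P F)}"

definition instr_enabled ::
  "('i, 'q, 'x, 'v) program \<Rightarrow> 'i \<Rightarrow> ('i, 'q, 'x, 'v) tso_conf \<Rightarrow> bool" where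
  "instr_enabled P i c \<longleftrightarrow> (\<exists>c'. instr_step P i c c')"

definition W_P ::
  "('i, 'q, 'x, 'v) program \<Rightarrow> (nat \<Rightarrow> ('i, 'q, 'x, 'v) tso_conf gconf) set" where
  "W_P P = {r. infinite_path (tso_game P) r \<and>
     (\<forall>i\<in>procs P.
        infinite {k. \<exists>c. r k = ConfA c \<and> instr_enabled P i c} \<longrightarrow>
        infinite {k. \<exists>c c'. r k = ConfA c \<and> r (Suc k) = ConfB c' \<and> instr_step P i c c'})}"


section \<open>Finite presentations of inputs\<close>

text \<open>Up to renaming, the data domain and the set of variables are initial segments of the
  natural numbers and the processes are numbered consecutively. Local states are
  arbitrary natural numbers, so the state sets of different processes may be
  disjoint or overlap, and \<open>F\<close> may single out states of some processes only.\<close>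

record tso_input =
  num_vals :: nat
  num_vars :: nat
  proc_list :: "(nat list \<times> (nat \<times> (nat, nat) instr \<times> nat) list) list"
  target_list :: "nat list"
  init_locs :: "nat list"
  init_bufs :: "(nat \<times> nat) list list"
  init_mem :: "nat list"

definition input_program :: "tso_input \<Rightarrow> (nat, nat, nat, nat) program" where
  "input_program I =
     \<lparr>vals = {..<num_vals I},
      vars = {..<num_vars I},
      procs = {..<length (proc_list I)},
      states = (\<lambda>i. set (fst (proc_list I ! i))),
      trans = (\<lambda>i. set (snd (proc_list I ! i)))\<rparr>"

definition input_targets :: "tso_input \<Rightarrow> nat set" where
  "input_targets I = set (target_list I)"

definition input_init :: "tso_input \<Rightarrow> (nat, nat, nat, nat) tso_conf" where
  "input_init I =
     \<lparr>loc = (\<lambda>i\<in>{..<length (proc_list I)}. init_locs I ! i),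
      buf = (\<lambda>i\<in>{..<length (proc_list I)}. init_bufs I ! i),
      mem = (\<lambda>x\<in>{..<num_vars I}. init_mem I ! x)\<rparr>"

definition wf_input :: "tso_input \<Rightarrow> bool" where
  "wf_input I \<longleftrightarrow>
     length (init_locs I) = length (proc_list I) \<and>
     length (init_bufs I) = length (proc_list I) \<and>
     length (init_mem I) = num_vars I \<and>
     wf_program (input_program I) \<and>
     input_targets I \<subseteq> local_states (input_program I) \<and>
     input_init I \<in> tso_confs (input_program I) \<and>
     ConfA (input_init I) \<notin> confs_hitting (input_program I) (input_targets I)"

fun encode_instr :: "(nat, nat) instr \<Rightarrow> nat" where
  "encode_instr (Rd x d) = prod_encode (0, prod_encode (x, d))"
| "encode_instr (Wr x d) = prod_encode (1, prod_encode (x, d))"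
| "encode_instr Skip = prod_encode (2, 0)"
| "encode_instr Mf = prod_encode (3, 0)"

fun encode_trans :: "nat \<times> (nat, nat) instr \<times> nat \<Rightarrow> nat" where
  "encode_trans (p, a, q) = prod_encode (p, prod_encode (encode_instr a, q))"

fun encode_proc :: "nat list \<times> (nat \<times> (nat, nat) instr \<times> nat) list \<Rightarrow> nat" where
  "encode_proc (Q, D) = prod_encode (list_encode Q, list_encode (map encode_trans D))"

definition encode_input :: "tso_input \<Rightarrow> nat" where
  "encode_input I = list_encode
     [num_vals I,
      num_vars I,
      list_encode (map encode_proc (proc_list I)),
      list_encode (target_list I),
      list_encode (init_locs I),
      list_encode (map (\<lambda>w. list_encode (map prod_encode w)) (init_bufs I)),
      list_encode (init_mem I)]"

lemma inj_encode_instr: "inj encode_instr"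
proof (rule injI)
  fix a b assume "encode_instr a = encode_instr b"
  then show "a = b"
    by (cases a; cases b) (auto simp: prod_encode_eq)
qed

lemma inj_encode_trans: "inj encode_trans"
proof (rule injI)
  fix a b assume "encode_trans a = encode_trans b"
  then show "a = b"
    by (cases a; cases b) (simp add: prod_encode_eq inj_eq[OF inj_encode_instr])
qed

lemma inj_encode_proc: "inj encode_proc"
proof (rule injI)
  fix a b assume "encode_proc a = encode_proc b"
  then show "a = b"
    by (cases a; cases b)
       (simp add: prod_encode_eq list_encode_eq inj_map_eq_map[OF inj_encode_trans])
qed

lemma inj_encode_input: "inj encode_input"
proof (rule injI)
  have inj_buf: "inj (\<lambda>w. list_encode (map prod_encode w))"
    by (rule injI) (simp add: list_encode_eq inj_map_eq_map inj_prod_encode)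
  fix I J :: tso_input
  assume "encode_input I = encode_input J"
  then show "I = J"
    by (cases I; cases J)
       (simp add: encode_input_def list_encode_eq inj_map_eq_map[OF inj_buf]
          inj_map_eq_map[OF inj_encode_proc] del: list_encode.simps)
qed


section \<open>Partial recursive functions and decidability\<close>

datatype recf = Zero | Succ | Proj nat | Comp recf "recf list" | PrimRec recf recf | Mu recf

inductive computes :: "recf \<Rightarrow> nat list \<Rightarrow> nat \<Rightarrow> bool" where
  zero: "computes Zero xs 0"
| succ: "computes Succ [x] (Suc x)"
| proj: "i < length xs \<Longrightarrow> computes (Proj i) xs (xs ! i)"
| comp: "\<lbrakk>list_all2 (\<lambda>g y. computes g xs y) gs ys; computes f ys z\<rbrakk> \<Longrightarrow> computes (Comp f gs) xs z"
| primrec_0: "computes f xs y \<Longrightarrow> computes (PrimRec f g) (0 # xs) y"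
| primrec_Suc: "\<lbrakk>computes (PrimRec f g) (n # xs) y; computes g (n # y # xs) z\<rbrakk>
    \<Longrightarrow> computes (PrimRec f g) (Suc n # xs) z"
| mu: "\<lbrakk>computes f (n # xs) 0; \<And>k. k < n \<Longrightarrow> \<exists>y. computes f (k # xs) (Suc y)\<rbrakk>
    \<Longrightarrow> computes (Mu f) xs n"

inductive_cases computes_cases:
  "computes Zero xs y" "computes Succ xs y" "computes (Proj i) xs y"
  "computes (Comp f gs) xs y" "computes (PrimRec f g) (0 # xs) y"
  "computes (PrimRec f g) (Suc n # xs) y" "computes (Mu f) xs y"

lemma computes_unique: "computes f xs y \<Longrightarrow> computes f xs z \<Longrightarrow> y = z"
proof (induction f xs y arbitrary: z rule: computes.induct)
  case (zero xs) then show ?case by (rule computes_cases) simp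
next
  case (succ x) then show ?case by (rule computes_cases) simp
next
  case (proj i xs) then show ?case by (auto elim: computes_cases)
next
  case (comp xs gs ys f z')
  from comp.prems obtain us where us: "list_all2 (\<lambda>g y. computes g xs y) gs us" "computes f us z"
    by (rule computes_cases)
  have "ys = us"
    using comp.IH(1) us(1) by (auto simp: list_all2_conv_all_nth intro!: nth_equalityI)
  then show ?case using comp.IH(2) us(2) by blast
next
  case (primrec_0 f xs y g)
  from primrec_0.prems have "computes f xs z" by (rule computes_cases)
  then show ?case by (rule primrec_0.IH)
next
  case (primrec_Suc f g n xs y z')
  from primrec_Suc.prems obtain u where
    "computes (PrimRec f g) (n # xs) u" "computes g (n # u # xs) z"
    by (rule computes_cases)
  then show ?case using primrec_Suc.IH by blast
next
  case (mu f n xs)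
  from mu.prems have z: "computes f (z # xs) 0" "\<forall>k<z. \<exists>y. computes f (k # xs) (Suc y)"
    by (auto elim: computes_cases)
  show ?case
  proof (rule linorder_cases)
    assume "n < z"
    then obtain y where "computes f (n # xs) (Suc y)" using z(2) by blast
    then show ?thesis using mu.IH(1) by blast
  next
    assume "z < n"
    then obtain y where "\<forall>u. computes f (z # xs) u \<longrightarrow> Suc y = u" using mu.IH(2) by blast
    then show ?thesis using z(1) by blast
  qed simp
qed

text \<open>The problem \<open>Y\<close> on the inputs \<open>D\<close>, presented through the encoding \<open>enc\<close>. Nothing is
  required of the algorithm on numbers that encode no element of \<open>D\<close>.\<close>

definition decidable_on :: "'a set \<Rightarrow> ('a \<Rightarrow> nat) \<Rightarrow> ('a \<Rightarrow> bool) \<Rightarrow> bool" where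
  "decidable_on D enc Y \<longleftrightarrow> (\<exists>f. \<forall>a\<in>D. computes f [enc a] (if Y a then 1 else 0))"

end

theory Submission
  imports Defs "HOL-Library.Countable"
begin

text \<open>
  The complement of the halting problem of queue machines reduces to the safety problem. Two
  processes suffice. The buffer of the writer is the queue; its messages alternate between two
  variables, and an update of the oldest message delivers the front symbol to the control process.
  The control process reads the symbol, resets the variable, and announces on a third variable the
  word to be appended, which the writer reads and appends. After the reset has reached the memory,
  the control process checks that the other one of the two variables is unset. If the update player
  has delivered more than one symbol, this check diverts the control process to a safe sink, so
  cheating makes the update player lose. While it waits, the writer spins by reading the old
  announcement, so withholding updates does not help the update player either. Conversely, the
  control process has a step to make as soon as a symbol is delivered, and fairness forbids the
  process player to let the writer spin forever. Hence, if the machine halts, honest updates force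
  the process player into the halting state.

  For the undecidability, the number of an instance is a fixed computable function of the
  code \<open>d\<close> of its processes if the machine is started on the input \<open>d\<close>. A decision procedure
  would therefore yield a machine that, started on the code of its own processes, halts iff the
  process player wins, that is, iff it does not halt. No universal machine is needed.
\<close>

section \<open>Computable functions\<close>

text \<open>A read returns the newest message in the process's own buffer first, so the writer
  cannot inspect the queue that its buffer holds. The front symbol has to pass through the memory to
  another process, and the word to be appended has to come back on a variable that the writer never
  writes. Since updates belong to the opponent, deliveries on a single variable could not be
  counted; on alternating variables a second one leaves a nonzero value in the wrong place.
  Announcements stay in the memory after they have been read, hence their parity bit. The update
  player keeps unread announcements from being overwritten by delivering the next symbol only after
  the last word has been appended. A queue is awkward to program directly, so stack programs serve
  as an intermediate language: with entries in unary, one rotation of the queue with finite control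
  performs a basic stack operation. The diagonal argument rests on a separation: the machine shapes
  only the process list of an instance, its input only the initial configuration.\<close>

definition computable :: "nat \<Rightarrow> (nat list \<Rightarrow> nat) \<Rightarrow> bool" where
  "computable k g \<longleftrightarrow> (\<exists>f. \<forall>xs. length xs = k \<longrightarrow> computes f xs (g xs))"

lemma computable_nth: "i < k \<Longrightarrow> computable k (\<lambda>xs. xs ! i)"
  unfolding computable_def by (metis computes.proj)

lemma computable_comp:
  assumes "computable (length gs) h" "\<And>g. g \<in> set gs \<Longrightarrow> computable k g"
  shows "computable k (\<lambda>xs. h (map (\<lambda>g. g xs) gs))"
proof -
  obtain f where f: "\<And>ys. length ys = length gs \<Longrightarrow> computes f ys (h ys)"
    using assms(1) unfolding computable_def by blast
  have "\<forall>g\<in>set gs. \<exists>r. \<forall>xs. length xs = k \<longrightarrow> computes r xs (g xs)"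
    using assms(2) unfolding computable_def by blast
  then obtain R where R: "\<And>g xs. g \<in> set gs \<Longrightarrow> length xs = k \<Longrightarrow> computes (R g) xs (g xs)"
    by metis
  have "computes (Comp f (map R gs)) xs (h (map (\<lambda>g. g xs) gs))" if "length xs = k" for xs
    by (rule computes.comp[where ys = "map (\<lambda>g. g xs) gs"])
      (use that R f in \<open>auto simp: list_all2_conv_all_nth\<close>)
  then show ?thesis unfolding computable_def by blast
qed

lemma computable_Suc: "computable k g \<Longrightarrow> computable k (\<lambda>xs. Suc (g xs))"
proof -
  assume g: "computable k g"
  have "computable (length [g]) (\<lambda>ys. Suc (ys ! 0))"
    unfolding computable_def using computes.succ
    by (metis length_0_conv length_Suc_conv list.size(4) nth_Cons_0 One_nat_def length_Cons)
  from computable_comp[OF this, of k] g show ?thesis by simp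
qed

lemma computable_const: "computable k (\<lambda>_. c)"
proof (induction c)
  case 0
  show ?case unfolding computable_def using computes.zero by blast
qed (rule computable_Suc)

lemma computable_comp1:
  assumes "computable 1 (\<lambda>xs. h (xs ! 0))" "computable k a"
  shows "computable k (\<lambda>xs. h (a xs))"
  using computable_comp[of "[a]" "\<lambda>xs. h (xs ! 0)" k] assms by simp

lemma computable_comp2:
  assumes "computable 2 (\<lambda>xs. h (xs ! 0) (xs ! 1))" "computable k a" "computable k b"
  shows "computable k (\<lambda>xs. h (a xs) (b xs))"
  using computable_comp[of "[a, b]" "\<lambda>xs. h (xs ! 0) (xs ! 1)" k] assms
  by (force simp: numeral_2_eq_2)

lemma computable_primrec:
  assumes b: "computable k b" and st: "computable (Suc (Suc k)) st"
    and h0: "\<And>xs. length xs = k \<Longrightarrow> h (0 # xs) = b xs"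
    and hS: "\<And>n xs. length xs = k \<Longrightarrow> h (Suc n # xs) = st (n # h (n # xs) # xs)"
  shows "computable (Suc k) h"
proof -
  obtain f where f: "\<And>xs. length xs = k \<Longrightarrow> computes f xs (b xs)"
    using b unfolding computable_def by blast
  obtain g where g: "\<And>xs. length xs = Suc (Suc k) \<Longrightarrow> computes g xs (st xs)"
    using st unfolding computable_def by blast
  have "computes (PrimRec f g) (n # xs) (h (n # xs))" if "length xs = k" for n xs
    by (induction n) (auto simp: h0 hS that intro!: primrec_0 primrec_Suc f g)
  then show ?thesis unfolding computable_def by (metis length_Suc_conv)
qed

lemma computable_rec:
  assumes "computable 2 (\<lambda>xs. st (xs ! 0) (xs ! 1))"
  shows "computable 1 (\<lambda>xs. rec_nat b st (xs ! 0))"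
  using computable_primrec[of 0 "\<lambda>_. b" "\<lambda>xs. st (xs ! 0) (xs ! 1)" "\<lambda>xs. rec_nat b st (xs ! 0)"]
    assms computable_const by (simp add: numeral_2_eq_2)

lemma computable_case:
  assumes "computable k a"
  shows "computable k (\<lambda>xs. if a xs = 0 then b else c)"
proof -
  have "(\<lambda>xs. if xs ! 0 = 0 then b else c) = (\<lambda>xs. rec_nat b (\<lambda>_ _. c) (xs ! 0))"
  proof
    show "(if xs ! 0 = 0 then b else c) = rec_nat b (\<lambda>_ _. c) (xs ! 0)" for xs
      by (cases "xs ! 0") simp_all
  qed
  then have "computable 1 (\<lambda>xs. if xs ! 0 = 0 then b else c)"
    using computable_rec[of "\<lambda>_ _. c" b] computable_const by simp
  from computable_comp1[OF this assms] show ?thesis .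
qed

lemma computable_add: "computable k a \<Longrightarrow> computable k b \<Longrightarrow> computable k (\<lambda>xs. a xs + b xs)"
proof (rule computable_comp2[where h = "(+)"])
  have "computable (Suc 1) (\<lambda>xs. xs ! 0 + xs ! 1)"
    by (rule computable_primrec[where b = "\<lambda>xs. xs ! 0" and st = "\<lambda>xs. Suc (xs ! 1)"])
      (simp_all add: computable_nth computable_Suc)
  then show "computable 2 (\<lambda>xs. xs ! 0 + xs ! 1)" by (simp add: numeral_2_eq_2)
qed

lemma computable_prod_encode:
  assumes "computable k a" "computable k b"
  shows "computable k (\<lambda>xs. prod_encode (a xs, b xs))"
proof -
  have "triangle n = rec_nat 0 (\<lambda>m t. t + Suc m) n" for n
    by (induction n) simp_all
  then have "computable 1 (\<lambda>xs. triangle (xs ! 0))"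
    using computable_rec[of "\<lambda>m t. t + Suc m" 0]
    by (simp add: computable_add computable_nth computable_Suc del: add_Suc_right)
  from computable_comp1[OF this computable_add[OF assms]] show ?thesis
    unfolding prod_encode_def using assms(1) by (simp add: computable_add)
qed

text \<open>Parity decides which of the two queue variables carries a given message of the initial
  buffer.\<close>

lemma computable_parity: "computable k a \<Longrightarrow> computable k (\<lambda>xs. a xs mod 2)"
proof (rule computable_comp1[where h = "\<lambda>n. n mod 2"])
  have "n mod 2 = rec_nat 0 (\<lambda>_ r. if r = 0 then 1 else 0) n" for n :: nat
  proof (induction n)
    case (Suc n)
    have "Suc n mod 2 = (if n mod 2 = 0 then 1 else 0)" by presburger
    then show ?case unfolding Suc.IH by simp
  qed simp
  moreover have "computable 1 (\<lambda>xs. rec_nat 0 (\<lambda>_ r. if r = 0 then 1 else 0) (xs ! 0))"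
    by (rule computable_rec, rule computable_case, rule computable_nth) simp
  ultimately show "computable 1 (\<lambda>xs. xs ! 0 mod 2)" by presburger
qed


section \<open>Stack programs\<close>

datatype cmd = Nop | Push | Del nat | Inc nat | Seq cmd cmd | Loop nat cmd

text \<open>\<open>Loop i c\<close> decrements the \<open>i\<close>-th entry before each execution of \<open>c\<close>, as long as it is nonzero.\<close>

inductive exec :: "cmd \<Rightarrow> nat list \<Rightarrow> nat list \<Rightarrow> bool" where
  Nop: "exec Nop s s"
| Push: "exec Push s (0 # s)"
| Del: "length s1 = i \<Longrightarrow> exec (Del i) (s1 @ n # s2) (s1 @ s2)"
| Inc: "length s1 = i \<Longrightarrow> exec (Inc i) (s1 @ n # s2) (s1 @ Suc n # s2)"
| Seq: "exec c s t \<Longrightarrow> exec d t u \<Longrightarrow> exec (Seq c d) s u"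
| Loop_0: "length s1 = i \<Longrightarrow> exec (Loop i c) (s1 @ 0 # s2) (s1 @ 0 # s2)"
| Loop_Suc: "length s1 = i \<Longrightarrow> exec c (s1 @ n # s2) t \<Longrightarrow> exec (Loop i c) t u
    \<Longrightarrow> exec (Loop i c) (s1 @ Suc n # s2) u"

fun iter :: "nat \<Rightarrow> cmd \<Rightarrow> cmd" where
  "iter 0 c = Nop"
| "iter (Suc n) c = Seq c (iter n c)"

text \<open>An entry can be inspected only by counting it down, so two copies are made and one of
  them is poured back. The offset 2 accounts for the two pushed entries.\<close>

definition copy :: "nat \<Rightarrow> cmd" where
  "copy i = Seq Push (Seq Push (Seq (Loop (i + 2) (Seq (Inc 0) (Inc 1)))
     (Seq (Loop 0 (Inc (i + 2))) (Del 0))))"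

text \<open>Each \<open>copy\<close> pushes the stack down by one, so the constant index
  \<open>d + n - 1\<close> meets the entries from the last to the first, and the copies keep their
  order.\<close>

definition copies :: "nat \<Rightarrow> nat \<Rightarrow> cmd" where
  "copies d n = iter n (copy (d + n - 1))"

text \<open>The last argument is evaluated first, so that the values end up in order. The
  \<open>length cs\<close> values already present lie above the parameters.\<close>

fun args :: "(nat \<Rightarrow> cmd) list \<Rightarrow> nat \<Rightarrow> cmd" where
  "args [] n = Nop"
| "args (c # cs) n = Seq (args cs n) (Seq (copies (length cs) n) (c n))"

text \<open>The loop keeps the stack in the form \<open>i # h i # l # xs\<close>: the index reached,
  the value there, the number of rounds left and the parameters. The calls of \<open>Del 2\<close>
  remove the old value and the old place of the index.\<close>

definition primrec_body :: "cmd \<Rightarrow> nat \<Rightarrow> cmd" where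
  "primrec_body g n = Seq (copies 3 n) (Seq (copy (n + 1)) (Seq (copy (n + 1))
     (Seq g (Seq (Del 2) (Seq (copy 1) (Seq (Del 2) (Inc 0)))))))"

text \<open>The program compiled from a function of arity \<open>n\<close> replaces the \<open>n\<close> topmost entries of the
  stack by the value. The arity is a parameter since \<open>recf\<close> does not determine it.\<close>

primrec compile :: "recf \<Rightarrow> nat \<Rightarrow> cmd" where
  "compile Zero = (\<lambda>n. Seq (iter n (Del 0)) Push)"
| "compile Succ = (\<lambda>n. Inc 0)"
| "compile (Proj i) = (\<lambda>n. Seq (copy i) (iter n (Del 1)))"
| "compile (Comp f gs) = (\<lambda>n. Seq (args (map compile gs) n) (Seq (compile f (length gs)) (iter n (Del 1))))"
| "compile (PrimRec f g) = (\<lambda>n. Seq (copies 1 (n - 1)) (Seq (compile f (n - 1)) (Seq Push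
     (Seq (Loop 2 (primrec_body (compile g (n + 1)) (n - 1))) (Seq (Del 0) (iter n (Del 1)))))))"
| "compile (Mu f) = (\<lambda>n. Seq Push (Seq (copies 1 n) (Seq (copy n) (Seq (compile f (n + 1))
     (Seq (Loop 0 (Seq (Del 0) (Seq (Inc 0) (Seq (copies 1 n) (Seq (copy n) (compile f (n + 1)))))))
       (Seq (Del 0) (iter n (Del 1))))))))"

section \<open>Correctness of compiled stack programs\<close>

lemma exec_Del0: "exec (Del 0) (n # s) s"
  and exec_Del1: "exec (Del 1) (m # n # s) (m # s)"
  and exec_Del2: "exec (Del 2) (l # m # n # s) (l # m # s)"
  and exec_Inc0: "exec (Inc 0) (n # s) (Suc n # s)"
  and exec_Inc1: "exec (Inc 1) (m # n # s) (m # Suc n # s)"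
  using exec.Del[of "[]" 0] exec.Del[of "[m]" 1] exec.Del[of "[l, m]" 2]
    exec.Inc[of "[]" 0] exec.Inc[of "[m]" 1] by simp_all

lemma exec_iter_Del0: "exec (iter (length xs) (Del 0)) (xs @ s) s"
  by (induction xs) (auto intro: exec.intros exec_Del0)

lemma exec_iter_Del1: "exec (iter (length xs) (Del 1)) (y # xs @ s) (y # s)"
  by (induction xs) (auto intro: exec.intros exec_Del1[unfolded One_nat_def])

lemma exec_copy:
  assumes "length s1 = i"
  shows "exec (copy i) (s1 @ n # s2) (n # s1 @ n # s2)"
proof -
  have up: "exec (Loop (i + 2) (Seq (Inc 0) (Inc 1))) (t # y # s1 @ n # s2) ((t + n) # (y + n) # s1 @ 0 # s2)"
    for t y
  proof (induction n arbitrary: t y)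
    case 0
    show ?case using exec.Loop_0[of "t # y # s1" "i + 2"] assms by simp
  next
    case (Suc n)
    have "exec (Seq (Inc 0) (Inc 1)) (t # y # s1 @ n # s2) (Suc t # Suc y # s1 @ n # s2)"
      by (rule exec.Seq[OF exec_Inc0 exec_Inc1])
    with exec.Loop_Suc[of "t # y # s1" "i + 2" "Seq (Inc 0) (Inc 1)" n s2, OF _ _ Suc.IH[of "Suc t" "Suc y"]]
    show ?case using assms by simp
  qed
  have down: "exec (Loop 0 (Inc (i + 2))) (t # y # s1 @ m # s2) (0 # y # s1 @ (t + m) # s2)" for t y m
  proof (induction t arbitrary: m)
    case 0
    show ?case using exec.Loop_0[of "[]" 0] by simp
  next
    case (Suc t)
    have "exec (Inc (i + 2)) (t # y # s1 @ m # s2) (t # y # s1 @ Suc m # s2)"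
      using exec.Inc[of "t # y # s1" "i + 2"] assms by simp
    from exec.Loop_Suc[of "[]" 0 _ t "y # s1 @ m # s2", OF _ _ Suc.IH[of "Suc m"]] this show ?case by simp
  qed
  show ?thesis unfolding copy_def
    using exec.Push exec.Push up[of 0 0] down[of n n 0] exec_Del0
    by (simp, blast intro: exec.Seq)
qed

text \<open>Generalised over the suffix \<open>zs\<close> that has already been copied: it occurs on
  top as well as in its old place, which keeps the position of the next entry at
  \<open>i\<close>.\<close>

lemma exec_iter_copy:
  assumes "length ds + length xs + length zs = Suc i"
  shows "exec (iter (length xs) (copy i)) (zs @ ds @ xs @ zs @ s) (xs @ zs @ ds @ xs @ zs @ s)"
  using assms
proof (induction xs arbitrary: zs rule: rev_induct)
  case Nil
  show ?case by (simp add: exec.Nop)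
next
  case (snoc x xs)
  have "exec (copy i) ((zs @ ds @ xs) @ x # zs @ s) (x # (zs @ ds @ xs) @ x # zs @ s)"
    by (rule exec_copy) (use snoc.prems in simp)
  moreover have "exec (iter (length xs) (copy i)) ((x # zs) @ ds @ xs @ (x # zs) @ s)
     (xs @ (x # zs) @ ds @ xs @ (x # zs) @ s)"
    by (rule snoc.IH) (use snoc.prems in simp)
  ultimately show ?case by (auto intro: exec.Seq)
qed

lemma exec_copies:
  assumes "length ds = d" "length xs = n"
  shows "exec (copies d n) (ds @ xs @ s) (xs @ ds @ xs @ s)"
proof (cases "xs = []")
  case True
  then show ?thesis using assms by (auto simp: copies_def intro: exec.Nop)
next
  case False
  then show ?thesis using exec_iter_copy[of ds xs "[]" "d + n - 1" s] assms
    by (cases xs) (auto simp: copies_def)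
qed

lemma exec_args:
  assumes "list_all2 (\<lambda>c y. \<forall>s. exec (c (length xs)) (xs @ s) (y # s)) cs ys"
  shows "exec (args cs (length xs)) (xs @ s) (ys @ xs @ s)"
  using assms
proof (induction rule: list_all2_induct)
  case Nil
  show ?case by (simp add: exec.Nop)
next
  case (Cons c cs y ys)
  then show ?case
    using exec_copies[of ys "length cs" xs "length xs" s]
    by (auto dest: list_all2_lengthD intro!: exec.Seq)
qed

text \<open>The derivation unfolds the recursion downwards, whereas the compiled loop runs upwards.
  The function \<open>h\<close> of intermediate values lets the loop invariant name the value at
  each index.\<close>

lemma computes_PrimRec_values:
  assumes "computes (PrimRec f g) (m # xs) z"
  shows "\<exists>h. computes f xs (h 0) \<and> (\<forall>i<m. computes g (i # h i # xs) (h (Suc i))) \<and> h m = z"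
  using assms
proof (induction m arbitrary: z)
  case 0
  then show ?case by (auto elim!: computes_cases(5) intro!: exI[of _ "\<lambda>_. z"])
next
  case (Suc m)
  from Suc.prems obtain y where y: "computes (PrimRec f g) (m # xs) y" "computes g (m # y # xs) z"
    by (rule computes_cases)
  from Suc.IH[OF y(1)] obtain h where
    h: "computes f xs (h 0)" "\<forall>i<m. computes g (i # h i # xs) (h (Suc i))" "h m = y" by blast
  show ?case
    by (rule exI[of _ "h(Suc m := z)"]) (use h y(2) in \<open>auto simp: less_Suc_eq\<close>)
qed

lemma exec_compile: "computes f xs y \<Longrightarrow> exec (compile f (length xs)) (xs @ s) (y # s)"
proof (induction f arbitrary: xs y s)
  case Zero
  then show ?case by (auto elim!: computes_cases(1) intro: exec.intros exec_iter_Del0)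
next
  case Succ
  then show ?case by (auto elim!: computes_cases(2) intro: exec_Inc0)
next
  case (Proj i)
  then have i: "i < length xs" "y = xs ! i" by (auto elim: computes_cases)
  have "exec (copy i) (take i xs @ xs ! i # drop (Suc i) xs @ s) (xs ! i # take i xs @ xs ! i # drop (Suc i) xs @ s)"
    by (rule exec_copy) (use i in simp)
  moreover have "take i xs @ xs ! i # drop (Suc i) xs @ s = xs @ s"
    using i id_take_nth_drop[of i xs] by (metis append_Cons append_assoc)
  ultimately have "exec (copy i) (xs @ s) (y # xs @ s)" using i by simp
  then show ?case using exec_iter_Del1[of xs y s] by (auto intro: exec.Seq)
next
  case (Comp f gs)
  from Comp.prems obtain ys where ys: "list_all2 (\<lambda>g y. computes g xs y) gs ys" "computes f ys y"
    by (rule computes_cases)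
  have "list_all2 (\<lambda>c y. \<forall>s. exec (c (length xs)) (xs @ s) (y # s)) (map compile gs) ys"
    using ys(1) Comp.IH(2) by (auto simp: list_all2_conv_all_nth)
  from exec_args[OF this] Comp.IH(1)[OF ys(2)] exec_iter_Del1[of xs y s] show ?case
    using ys(1)[THEN list_all2_lengthD] by (auto intro!: exec.Seq)
next
  case (PrimRec f g)
  from PrimRec.prems obtain m xs' where xs: "xs = m # xs'"
    by (auto elim: computes.cases)
  from computes_PrimRec_values[OF PrimRec.prems[unfolded xs]] obtain h where
    h: "computes f xs' (h 0)" "\<And>i. i < m \<Longrightarrow> computes g (i # h i # xs') (h (Suc i))" "h m = y" by blast
  let ?n = "length xs'" and ?g = "compile g (length xs' + 2)"
  have body: "exec (primrec_body ?g ?n) (i # h i # l # xs' @ s) (Suc i # h (Suc i) # l # xs' @ s)"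
    if "i < m" for i l
  proof -
    have 1: "exec (copies 3 ?n) (i # h i # l # xs' @ s) (xs' @ i # h i # l # xs' @ s)"
      using exec_copies[of "[i, h i, l]" 3 xs' ?n s] by simp
    have 3: "exec (copy (?n + 1)) (xs' @ i # h i # l # xs' @ s) (h i # xs' @ i # h i # l # xs' @ s)"
      using exec_copy[of "xs' @ [i]" "?n + 1" "h i"] by simp
    have 4: "exec (copy (?n + 1)) (h i # xs' @ i # h i # l # xs' @ s) (i # h i # xs' @ i # h i # l # xs' @ s)"
      using exec_copy[of "h i # xs'" "?n + 1" i] by simp
    have 5: "exec ?g (i # h i # xs' @ i # h i # l # xs' @ s) (h (Suc i) # i # h i # l # xs' @ s)"
      using PrimRec.IH(2)[OF h(2)[OF that]] by simp
    have 6: "exec (copy 1) (h (Suc i) # i # l # xs' @ s) (i # h (Suc i) # i # l # xs' @ s)"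
      using exec_copy[of "[h (Suc i)]" 1 i] by simp
    show ?thesis unfolding primrec_body_def
      by (rule exec.Seq[OF 1 exec.Seq[OF 3 exec.Seq[OF 4 exec.Seq[OF 5 exec.Seq[OF exec_Del2
        exec.Seq[OF 6 exec.Seq[OF exec_Del2 exec_Inc0]]]]]]])
  qed
  have loop: "exec (Loop 2 (primrec_body ?g ?n)) (i # h i # l # xs' @ s) (m # h m # 0 # xs' @ s)"
    if "i + l = m" for i l
    using that
  proof (induction l arbitrary: i)
    case 0
    then show ?case using exec.Loop_0[of "[i, h i]" 2] by simp
  next
    case (Suc l)
    show ?case
      using exec.Loop_Suc[of "[i, h i]" 2 _ l "xs' @ s"] body[of i l] Suc.IH[of "Suc i"] Suc.prems
      by simp
  qed
  have 1: "exec (copies 1 ?n) (m # xs' @ s) (xs' @ m # xs' @ s)"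
    using exec_copies[of "[m]" 1 xs' ?n s] by simp
  have 2: "exec (iter (length xs) (Del 1)) (y # 0 # xs' @ s) (y # s)"
    using exec_iter_Del1[of "0 # xs'" y s] xs by simp
  have "exec (Seq (copies 1 ?n) (Seq (compile f ?n) (Seq Push (Seq (Loop 2 (primrec_body ?g ?n))
     (Seq (Del 0) (iter (length xs) (Del 1))))))) (m # xs' @ s) (y # s)"
    by (rule exec.Seq[OF 1 exec.Seq[OF PrimRec.IH(1)[OF h(1)] exec.Seq[OF exec.Push exec.Seq[OF
        loop[of 0 m, unfolded h(3)] exec.Seq[OF exec_Del0 2]]]]]) simp
  then show ?case using xs by simp
next
  case (Mu f)
  from Mu.prems have y: "computes f (y # xs) 0" "\<And>k. k < y \<Longrightarrow> \<exists>v. computes f (k # xs) (Suc v)"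
    by (auto elim: computes_cases)
  let ?n = "length xs" and ?f = "compile f (length xs + 1)"
  let ?c = "Seq (copies 1 (length xs)) (Seq (copy (length xs)) (compile f (length xs + 1)))"
  have run: "exec (Seq (copies 1 ?n) (Seq (copy ?n) (Seq ?f r))) (k # xs @ s) t"
    and run': "exec ?c (k # xs @ s) (v # k # xs @ s)"
    if "computes f (k # xs) v" "exec r (v # k # xs @ s) t" for k v r t
  proof -
    have 1: "exec (copies 1 ?n) (k # xs @ s) (xs @ k # xs @ s)"
      using exec_copies[of "[k]" 1 xs ?n s] by simp
    have 2: "exec (copy ?n) (xs @ k # xs @ s) (k # xs @ k # xs @ s)"
      by (rule exec_copy) simp
    have 3: "exec ?f (k # xs @ k # xs @ s) (v # k # xs @ s)"
      using Mu.IH[OF that(1)] by simp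
    show "exec (Seq (copies 1 ?n) (Seq (copy ?n) (Seq ?f r))) (k # xs @ s) t"
      by (rule exec.Seq[OF 1 exec.Seq[OF 2 exec.Seq[OF 3 that(2)]]])
    show "exec ?c (k # xs @ s) (v # k # xs @ s)"
      by (rule exec.Seq[OF 1 exec.Seq[OF 2 3]])
  qed
  \<comment> \<open>The body first discards the decremented value and then recomputes
    \<open>f\<close> at the next candidate, so this loop acts as a while loop with the test "value
    nonzero".\<close>
  let ?L = "Loop 0 (Seq (Del 0) (Seq (Inc 0) ?c))"
  have loop: "exec ?L (v # k # xs @ s) (0 # y # xs @ s)"
    if "k + l = y" "computes f (k # xs) v" for k l v
    using that
  proof (induction l arbitrary: k v)
    case 0
    then have "v = 0" using y(1) computes_unique by fastforce
    then show ?case using 0 exec.Loop_0[of "[]" 0] by simp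
  next
    case (Suc l)
    then obtain w where w: "computes f (k # xs) (Suc w)" using y(2)[of k] by auto
    then have v: "v = Suc w" using Suc.prems(2) computes_unique by blast
    obtain v' where v': "computes f (Suc k # xs) v'"
      using y Suc.prems(1) by (metis add_Suc_right add_Suc_shift less_add_Suc1 nat_less_le le_add1)
    have "exec (Seq (Del 0) (Seq (Inc 0) ?c)) (w # k # xs @ s) (v' # Suc k # xs @ s)"
      by (rule exec.Seq[OF exec_Del0 exec.Seq[OF exec_Inc0 run'[OF v' exec.Nop]]])
    moreover have "exec ?L (v' # Suc k # xs @ s) (0 # y # xs @ s)"
      by (rule Suc.IH) (use Suc.prems v' in auto)
    ultimately show ?case using exec.Loop_Suc[of "[]" 0 _ w "k # xs @ s"] v by simp
  qed
  obtain v where v: "computes f (0 # xs) v" using y by (cases y) auto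
  show ?case
    using exec.Seq[OF exec.Push run[OF v exec.Seq[OF loop[OF _ v] exec.Seq[OF exec_Del0 exec_iter_Del1]]], of y]
    by simp
qed


section \<open>Queue machines\<close>

inductive qstep :: "(nat \<Rightarrow> nat \<Rightarrow> nat list \<times> nat) \<Rightarrow> nat \<times> nat list \<Rightarrow> nat \<times> nat list \<Rightarrow> bool"
  for \<delta> where
  "q \<noteq> 0 \<Longrightarrow> \<delta> q a = (w, q') \<Longrightarrow> qstep \<delta> (q, a # u) (q', u @ w)"

text \<open>The state counts the blocks that have been passed. \<open>Del i\<close> needs further
  states for erasing the block and for copying the rest, \<open>Inc i\<close> one for copying the
  rest. \<open>Loop i\<close> needs one behind the marker of the tested block, one for "zero" and
  one for "unit removed"; its body follows.\<close>

fun code_size :: "cmd \<Rightarrow> nat" where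
  "code_size Nop = 1"
| "code_size Push = 2"
| "code_size (Del i) = i + 3"
| "code_size (Inc i) = i + 2"
| "code_size (Seq c d) = code_size c + code_size d"
| "code_size (Loop i c) = i + 4 + code_size c"

text \<open>The program occupies the states from \<open>q0\<close> to \<open>q0 + code_size c - 1\<close> and leaves to \<open>qx\<close>. The symbols
  are 1 (unit), 2 (start of a block) and 3 (end of the stack). Each operation rotates the queue once,
  and reading 3 ends the rotation.\<close>

fun code_step :: "cmd \<Rightarrow> nat \<Rightarrow> nat \<Rightarrow> nat \<Rightarrow> nat \<Rightarrow> nat list \<times> nat" where
  "code_step Nop q0 qx q a = ([a], if a = 3 then qx else q)"
| "code_step Push q0 qx q a = (if q = q0 then [2, a] else [a], if a = 3 then qx else q0 + 1)"
| "code_step (Del i) q0 qx q a =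
     (if a = 3 then ([3], qx)
      else if a = 2 then (if q = q0 + i then [] else [2], if q \<le> q0 + i + 1 then Suc q else q)
      else (if q = q0 + i + 1 then [] else [a], q))"
| "code_step (Inc i) q0 qx q a =
     (if a = 3 then ([3], qx)
      else if a = 2 then (if q = q0 + i then [2, 1] else [2], if q \<le> q0 + i then Suc q else q)
      else ([a], q))"
| "code_step (Seq c d) q0 qx q a =
     (if q < q0 + code_size c then code_step c q0 (q0 + code_size c) q a else code_step d (q0 + code_size c) qx q a)"
| "code_step (Loop i c) q0 qx q a =
     (if q \<ge> q0 + i + 4 then code_step c (q0 + i + 4) q0 q a
      else if a = 3 then ([3], if q = q0 + i + 3 then q0 + i + 4 else qx)
      else if a = 2 then ([2], if q \<le> q0 + i + 1 then Suc q else q)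
      else if q = q0 + i + 1 then ([], q0 + i + 3) else ([a], q))"

section \<open>Simulation of stack programs by rotations of the queue\<close>

lemma code_size_pos: "0 < code_size c"
  by (induction c) auto

lemma code_step_bounds:
  assumes "code_step c q0 qx q a = (w, q')" "q0 \<le> q" "q < q0 + code_size c" "a \<in> {1, 2, 3}"
  shows "set w \<subseteq> {1, 2, 3} \<and> length w \<le> 2 \<and> (q' = qx \<or> q0 \<le> q' \<and> q' < q0 + code_size c)"
  using assms
proof (induction c arbitrary: q0 qx)
  case (Seq c d)
  show ?case
  proof (cases "q < q0 + code_size c")
    case True
    then show ?thesis using Seq.IH(1)[of q0 "q0 + code_size c"] Seq.prems code_size_pos[of d] by auto
  next
    case False
    then show ?thesis using Seq.IH(2)[of "q0 + code_size c" qx] Seq.prems by auto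
  qed
next
  case (Loop i c)
  show ?case
  proof (cases "q \<ge> q0 + i + 4")
    case True
    then show ?thesis using Loop.IH[of "q0 + i + 4" q0] Loop.prems by auto
  next
    case False
    then show ?thesis using Loop.prems code_size_pos[of c] by (auto split: if_splits)
  qed
qed (auto split: if_splits)

text \<open>Unary entries make increment and decrement local: one symbol is inserted or dropped
  right behind the marker 2.\<close>

definition blocks :: "nat list \<Rightarrow> nat list" where
  "blocks s = concat (map (\<lambda>n. 2 # replicate n 1) s)"

lemma blocks_simps [simp]:
  "blocks [] = []" "blocks (n # s) = 2 # replicate n 1 @ blocks s" "blocks (s @ t) = blocks s @ blocks t"
  by (simp_all add: blocks_def)

lemma set_blocks: "set (blocks s) \<subseteq> {1, 2}"
  by (induction s) auto

text \<open>The bound on \<open>q0\<close> keeps the program away from the halting state 0, while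
  \<open>qx\<close> may be 0, so that leaving the program can mean halting.\<close>

definition implements :: "(nat \<Rightarrow> nat \<Rightarrow> nat list \<times> nat) \<Rightarrow> cmd \<Rightarrow> nat \<Rightarrow> nat \<Rightarrow> bool" where
  "implements \<delta> c q0 qx \<longleftrightarrow> 0 < q0 \<and> (\<forall>q a. q0 \<le> q \<and> q < q0 + code_size c \<longrightarrow> \<delta> q a = code_step c q0 qx q a)"

lemma implementsD:
  "implements \<delta> c q0 qx \<Longrightarrow> q0 \<le> q \<Longrightarrow> q < q0 + code_size c \<Longrightarrow> \<delta> q a = code_step c q0 qx q a"
  by (simp add: implements_def)

abbreviation qsteps where "qsteps \<delta> \<equiv> (qstep \<delta>)\<^sup>*\<^sup>*"

lemma qstepsI: "q \<noteq> 0 \<Longrightarrow> \<delta> q a = (w, q') \<Longrightarrow> qsteps \<delta> (q', u @ w) d \<Longrightarrow> qsteps \<delta> (q, a # u) d"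
  by (blast intro: converse_rtranclp_into_rtranclp qstep.intros)

lemma rotate_symbols:
  assumes "q \<noteq> 0" "\<And>a. a \<in> set v \<Longrightarrow> \<delta> q a = ([a], q)"
  shows "qsteps \<delta> (q, v @ u) (q, u @ v)"
  using assms(2)
proof (induction v arbitrary: u)
  case (Cons a v)
  then have "qsteps \<delta> (q, v @ u @ [a]) (q, (u @ [a]) @ v)" by (metis list.set_intros(2) append_assoc)
  then show ?case using assms(1) Cons.prems[of a] by (auto intro: qstepsI)
qed simp

lemma rotate_exit:
  assumes "q \<noteq> 0" "\<And>a. a \<in> set v \<Longrightarrow> \<delta> q a = ([a], q)" "\<delta> q 3 = ([3], q')"
  shows "qsteps \<delta> (q, v @ 3 # u) (q', u @ v @ [3])"
proof -
  have "qsteps \<delta> (q, 3 # u @ v) (q', u @ v @ [3])"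
    using assms by (auto intro: qstepsI)
  then show ?thesis using rotate_symbols[of q v \<delta> "3 # u"] assms(1,2) by simp
qed

lemma skip_blocks:
  assumes "0 < q0" "\<And>j. j < length s \<Longrightarrow> \<delta> (q0 + j) 2 = ([2], Suc (q0 + j))"
    and "\<And>j. j \<le> length s \<Longrightarrow> \<delta> (q0 + j) 1 = ([1], q0 + j)"
  shows "qsteps \<delta> (q0, blocks s @ u) (q0 + length s, u @ blocks s)"
  using assms
proof (induction s arbitrary: u rule: rev_induct)
  case (snoc n s)
  have "qsteps \<delta> (q0 + length s, 2 # replicate n 1 @ u @ blocks s)
    (Suc (q0 + length s), (u @ blocks s @ [2]) @ replicate n 1)"
    using rotate_symbols[of "Suc (q0 + length s)" "replicate n 1" \<delta> "u @ blocks s @ [2]"]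
      snoc.prems(2)[of "length s"] snoc.prems(3)[of "Suc (length s)"] snoc.prems(1)
    by (auto intro: qstepsI)
  moreover have "qsteps \<delta> (q0, blocks s @ 2 # replicate n 1 @ u)
    (q0 + length s, (2 # replicate n 1 @ u) @ blocks s)"
    by (rule snoc.IH) (use snoc.prems in auto)
  ultimately show ?case by simp
qed simp

lemma delete_units:
  assumes "q \<noteq> 0" "\<delta> q 1 = ([], q)"
  shows "qsteps \<delta> (q, replicate n 1 @ u) (q, u)"
proof (induction n)
  case (Suc n)
  then show ?case using assms by (auto intro: qstepsI)
qed simp

text \<open>Kept apart from the induction on \<open>exec\<close> because the endless loop of
  \<open>halt_on_zero\<close> uses it as well, and a diverging loop has no \<open>exec\<close>
  derivation.\<close>

lemma loop_enter:
  assumes "implements \<delta> (Loop (length s1) c) q0 qx"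
  shows "qsteps \<delta> (q0, blocks (s1 @ Suc n # s2) @ [3]) (q0 + length s1 + 4, blocks (s1 @ n # s2) @ [3])"
proof -
  note d = implementsD[OF assms]
  have q0: "0 < q0" using assms by (simp add: implements_def)
  let ?q = "q0 + length s1"
  have "qsteps \<delta> (q0, blocks s1 @ 2 # 1 # replicate n 1 @ blocks s2 @ [3])
    (?q, (2 # 1 # replicate n 1 @ blocks s2 @ [3]) @ blocks s1)"
    by (rule skip_blocks) (use q0 in \<open>simp_all add: d\<close>)
  \<comment> \<open>Here the marker of the tested entry is kept and its first unit dropped; state
    \<open>?q + 3\<close> remembers this until the end of the rotation.\<close>
  moreover have "qsteps \<delta> (?q, 2 # 1 # replicate n 1 @ blocks s2 @ [3] @ blocks s1)
    (?q + 3, (replicate n 1 @ blocks s2) @ 3 # blocks s1 @ [2])"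
    using q0 by (auto intro!: qstepsI simp: d)
  moreover have "qsteps \<delta> (?q + 3, (replicate n 1 @ blocks s2) @ 3 # blocks s1 @ [2])
    (?q + 4, (blocks s1 @ [2]) @ (replicate n 1 @ blocks s2) @ [3])"
    by (rule rotate_exit) (use q0 set_blocks[of s2] in \<open>auto simp: d split: if_splits\<close>)
  ultimately show ?thesis by simp
qed

lemma qsteps_exec:
  assumes "exec c s t" "implements \<delta> c q0 qx"
  shows "qsteps \<delta> (q0, blocks s @ [3]) (qx, blocks t @ [3])"
  using assms
proof (induction arbitrary: q0 qx)
  case (Nop s)
  note d = implementsD[OF Nop]
  have q0: "0 < q0" using Nop by (simp add: implements_def)
  show ?case using rotate_exit[of q0 "blocks s" \<delta> qx "[]"] q0 set_blocks[of s] by (fastforce simp: d)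
next
  case (Push s)
  note d = implementsD[OF Push]
  have q0: "0 < q0" using Push by (simp add: implements_def)
  show ?case
  proof (cases s)
    case Nil
    then show ?thesis using q0 by (auto intro!: qstepsI simp: d)
  next
    case (Cons n s')
    have "qsteps \<delta> (Suc q0, (replicate n 1 @ blocks s') @ 3 # [2, 2])
      (qx, [2, 2] @ (replicate n 1 @ blocks s') @ [3])"
      by (rule rotate_exit) (use q0 set_blocks[of s'] in \<open>auto simp: d\<close>)
    then show ?thesis using q0 Cons by (auto intro!: qstepsI simp: d)
  qed
next
  case (Del s1 i n s2)
  note d = implementsD[OF Del(2)]
  have q0: "0 < q0" using Del(2) by (simp add: implements_def)
  let ?q = "q0 + length s1"
  have "qsteps \<delta> (q0, blocks s1 @ 2 # replicate n 1 @ blocks s2 @ [3])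
    (?q, (2 # replicate n 1 @ blocks s2 @ [3]) @ blocks s1)"
    by (rule skip_blocks) (use q0 Del(1) in \<open>simp_all add: d\<close>)
  moreover have "qsteps \<delta> (?q, 2 # replicate n 1 @ blocks s2 @ [3] @ blocks s1)
    (Suc ?q, blocks s2 @ [3] @ blocks s1)"
    using delete_units[of "Suc ?q" \<delta> n "blocks s2 @ [3] @ blocks s1"] q0 Del(1)
    by (auto intro!: qstepsI simp: d)
  moreover have "qsteps \<delta> (Suc ?q, blocks s2 @ 3 # blocks s1) (qx, blocks s1 @ blocks s2 @ [3])"
  proof (cases s2)
    case Nil
    then show ?thesis using q0 Del(1) by (auto intro!: qstepsI simp: d)
  next
    case (Cons m s3)
    have "qsteps \<delta> (Suc (Suc ?q), (replicate m 1 @ blocks s3) @ 3 # blocks s1 @ [2])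
      (qx, (blocks s1 @ [2]) @ (replicate m 1 @ blocks s3) @ [3])"
      by (rule rotate_exit) (use q0 set_blocks[of s3] Del(1) in \<open>auto simp: d\<close>)
    then show ?thesis using q0 Del(1) Cons by (auto intro!: qstepsI simp: d)
  qed
  ultimately show ?case by simp
next
  case (Inc s1 i n s2)
  note d = implementsD[OF Inc(2)]
  have q0: "0 < q0" using Inc(2) by (simp add: implements_def)
  let ?q = "q0 + length s1"
  have "qsteps \<delta> (q0, blocks s1 @ 2 # replicate n 1 @ blocks s2 @ [3])
    (?q, (2 # replicate n 1 @ blocks s2 @ [3]) @ blocks s1)"
    by (rule skip_blocks) (use q0 Inc(1) in \<open>simp_all add: d\<close>)
  moreover have "qsteps \<delta> (Suc ?q, (replicate n 1 @ blocks s2) @ 3 # blocks s1 @ [2, 1])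
    (qx, (blocks s1 @ [2, 1]) @ (replicate n 1 @ blocks s2) @ [3])"
    by (rule rotate_exit) (use q0 set_blocks[of s2] Inc(1) in \<open>auto simp: d\<close>)
  then have "qsteps \<delta> (?q, 2 # replicate n 1 @ blocks s2 @ 3 # blocks s1)
    (qx, (blocks s1 @ [2, 1]) @ (replicate n 1 @ blocks s2) @ [3])"
    using q0 Inc(1) by (auto intro!: qstepsI simp: d)
  ultimately show ?case by (simp add: replicate_app_Cons_same)
next
  case (Seq c s t d u)
  have "implements \<delta> c q0 (q0 + code_size c)" "implements \<delta> d (q0 + code_size c) qx"
    using Seq.prems code_size_pos[of c] by (auto simp: implements_def)
  with Seq.IH show ?case by (meson rtranclp_trans)
next
  case (Loop_0 s1 i c s2)
  note d = implementsD[OF Loop_0(2)]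
  have q0: "0 < q0" using Loop_0(2) by (simp add: implements_def)
  let ?q = "q0 + length s1"
  have "qsteps \<delta> (q0, blocks s1 @ 2 # blocks s2 @ [3]) (?q, (2 # blocks s2 @ [3]) @ blocks s1)"
    by (rule skip_blocks) (use q0 Loop_0(1) in \<open>simp_all add: d\<close>)
  moreover have "qsteps \<delta> (Suc ?q, blocks s2 @ 3 # blocks s1 @ [2])
    (qx, blocks s1 @ 2 # blocks s2 @ [3])"
  proof (cases s2)
    case Nil
    then show ?thesis using q0 Loop_0(1) by (auto intro!: qstepsI simp: d)
  next
    case (Cons m s3)
    have "qsteps \<delta> (Suc (Suc ?q), (replicate m 1 @ blocks s3) @ 3 # blocks s1 @ [2, 2])
      (qx, (blocks s1 @ [2, 2]) @ (replicate m 1 @ blocks s3) @ [3])"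
      by (rule rotate_exit) (use q0 set_blocks[of s3] Loop_0(1) in \<open>auto simp: d split: if_splits\<close>)
    then show ?thesis using q0 Loop_0(1) Cons by (auto intro!: qstepsI simp: d)
  qed
  then have "qsteps \<delta> (?q, 2 # blocks s2 @ 3 # blocks s1) (qx, blocks s1 @ 2 # blocks s2 @ [3])"
    using q0 Loop_0(1) by (auto intro!: qstepsI simp: d)
  ultimately show ?case by simp
next
  case (Loop_Suc s1 i c n s2 t u)
  have "implements \<delta> c (q0 + i + 4) q0"
    using Loop_Suc.prems by (auto simp: implements_def)
  from Loop_Suc.IH(1)[OF this] Loop_Suc.IH(2)[OF Loop_Suc.prems]
  show ?case using loop_enter[of \<delta> s1 c q0 qx n s2] Loop_Suc.prems Loop_Suc.hyps(1)
    by (meson rtranclp_trans)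
qed

section \<open>Divergence of queue machines\<close>

lemma qstep_deterministic: "qstep \<delta> c d \<Longrightarrow> qstep \<delta> c d' \<Longrightarrow> d = d'"
  by (auto elim!: qstep.cases)

text \<open>By determinism a halting run would pass through \<open>d\<close>, and the halting
  configuration would then lie on the cycle, although it has no successor.\<close>

lemma cycle_never_halts:
  assumes "qsteps \<delta> c d" "(qstep \<delta>)\<^sup>+\<^sup>+ d d"
  shows "\<not> qsteps \<delta> c (0, u)"
proof
  have stuck: "\<not> qstep \<delta> (0, u) e" for e by (auto elim: qstep.cases)
  assume "qsteps \<delta> c (0, u)"
  with assms(1) have "qsteps \<delta> d (0, u)"
  proof (induction rule: converse_rtranclp_induct)
    case (step c e)
    then show ?case using stuck qstep_deterministic by (metis converse_rtranclpE)
  qed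
  then have "(qstep \<delta>)\<^sup>+\<^sup>+ (0, u) (0, u)"
  proof (induction rule: rtranclp_induct)
    case base
    show ?case by (rule assms(2))
  next
    case (step e f)
    then have "qsteps \<delta> f e" using qstep_deterministic by (metis tranclpD)
    with step.hyps(2) show ?case by simp
  qed
  then show False using stuck by (meson tranclpD)
qed

text \<open>The loop restores the top of the stack, so it never ends on a nonzero value.\<close>

definition halt_on_zero :: "cmd \<Rightarrow> cmd" where
  "halt_on_zero c = Seq c (Loop 0 (Inc 0))"

lemma halt_on_zero_halts_iff:
  assumes "exec c s (y # t)"
  shows "(\<exists>u. qsteps (code_step (halt_on_zero c) 1 0) (1, blocks s @ [3]) (0, u)) \<longleftrightarrow> y = 0"
proof -
  let ?\<delta> = "code_step (halt_on_zero c) 1 0" and ?q = "1 + code_size c"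
  have c: "implements ?\<delta> c 1 ?q" and l: "implements ?\<delta> (Loop 0 (Inc 0)) ?q 0"
    and i: "implements ?\<delta> (Inc 0) (?q + 4) ?q"
    by (auto simp: implements_def halt_on_zero_def)
  note run = qsteps_exec[OF assms c]
  show ?thesis
  proof (cases y)
    case 0
    have "exec (Loop 0 (Inc 0)) (0 # t) (0 # t)" using exec.Loop_0[of "[]" 0] by simp
    from qsteps_exec[OF this l] run 0 show ?thesis by (meson rtranclp_trans)
  next
    case (Suc n)
    have "qsteps ?\<delta> (?q, blocks (y # t) @ [3]) (?q + 4, blocks (n # t) @ [3])"
      using loop_enter[of ?\<delta> "[]" "Inc 0" ?q 0 n t] l Suc by simp
    moreover have "qsteps ?\<delta> (?q + 4, blocks (n # t) @ [3]) (?q, blocks (y # t) @ [3])"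
      using qsteps_exec[OF exec_Inc0 i, of n t] Suc by simp
    \<comment> \<open>The round trip is nonempty because it passes through two different states,
      \<open>?q\<close> and \<open>?q + 4\<close>.\<close>
    ultimately have "(qstep ?\<delta>)\<^sup>+\<^sup>+ (?q, blocks (y # t) @ [3]) (?q, blocks (y # t) @ [3])"
      by (metis (no_types, lifting) add_cancel_right_right prod.inject rtranclpD rtranclp_tranclp_tranclp zero_neq_numeral)
    from cycle_never_halts[OF run this] Suc show ?thesis by blast
  qed
qed


section \<open>Criteria for winning TSO games\<close>

lemma instr_step_confs:
  assumes "wf_program P" "i \<in> procs P" "c \<in> tso_confs P" "instr_step P i c c'"
  shows "c' \<in> tso_confs P"
proof -
  have compile: "trans P i \<subseteq> states P i \<times> instrs P \<times> states P i"
    using assms(1,2) by (simp add: wf_program_def)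
  from assms(4) show ?thesis
  proof cases
    case (wr x d q)
    then have "q \<in> states P i" "x \<in> vars P" "d \<in> vals P" using compile by (auto simp: instrs_def)
    then show ?thesis using assms(2,3) wr
      by (auto simp: tso_confs_def PiE_iff extensional_def)
  qed (use compile assms(2,3) in \<open>auto simp: tso_confs_def PiE_iff extensional_def\<close>)
qed

lemma updates_confs: "(update_step P)\<^sup>*\<^sup>* c c' \<Longrightarrow> c \<in> tso_confs P \<Longrightarrow> c' \<in> tso_confs P"
proof (induction rule: rtranclp_induct)
  case (step c d)
  from step.hyps(2) step.IH[OF step.prems] show ?case
  proof cases
    case (1 i w x v)
    have "set (buf c i) \<subseteq> vars P \<times> vals P"
      using 1(2) step.IH[OF step.prems] by (auto simp: tso_confs_def PiE_iff)
    then have "set w \<subseteq> vars P \<times> vals P" "x \<in> vars P" "v \<in> vals P" using 1(3) by auto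
    then show ?thesis using 1 step.IH[OF step.prems]
      by (auto simp: tso_confs_def PiE_iff extensional_def)
  qed
qed

lemma tso_game_simps [simp]:
  "ConfA c \<in> confsA (tso_game P) \<longleftrightarrow> c \<in> tso_confs P"
  "ConfB c \<in> confsB (tso_game P) \<longleftrightarrow> c \<in> tso_confs P"
  "ConfA c \<notin> confsB (tso_game P)" "ConfB c \<notin> confsA (tso_game P)"
  by (auto simp: tso_game_def)

lemma moves_tso_game:
  "(ConfA c, g) \<in> moves (tso_game P) \<longleftrightarrow>
     (\<exists>d i. g = ConfB d \<and> c \<in> tso_confs P \<and> d \<in> tso_confs P \<and> i \<in> procs P \<and> instr_step P i c d)"
  "(ConfB c, g) \<in> moves (tso_game P) \<longleftrightarrow>
     (\<exists>d. g = ConfA d \<and> c \<in> tso_confs P \<and> d \<in> tso_confs P \<and> (update_step P)\<^sup>*\<^sup>* c d)"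
  by (auto simp: tso_game_def)

lemma B_not_dead: "c \<in> tso_confs P \<Longrightarrow> \<not> dead (tso_game P) (ConfB c)"
  by (auto simp: dead_def moves_tso_game)

lemma infinite_path_alternates:
  assumes "infinite_path (tso_game P) r" "r 0 = ConfA c0"
  obtains c d where "c 0 = c0" "\<And>j. r (2 * j) = ConfA (c j)" "\<And>j. r (2 * j + 1) = ConfB (d j)"
    "\<And>j. c j \<in> tso_confs P" "\<And>j. d j \<in> tso_confs P"
    "\<And>j. \<exists>i\<in>procs P. instr_step P i (c j) (d j)"
    "\<And>j. (update_step P)\<^sup>*\<^sup>* (d j) (c (Suc j))"
proof -
  have step: "(r k, r (Suc k)) \<in> moves (tso_game P)" for k
    using assms(1) by (simp add: infinite_path_def)
  have A: "\<exists>x. r (2 * j) = ConfA x" for j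
  proof (induction j)
    case (Suc j)
    then show ?case
      using step[of "2 * j"] step[of "Suc (2 * j)"] by (auto simp: moves_tso_game)
  qed (use assms(2) in simp)
  then obtain c where c: "\<And>j. r (2 * j) = ConfA (c j)" by metis
  have "\<exists>x. r (2 * j + 1) = ConfB x" for j
    using step[of "2 * j"] c[of j] by (auto simp: moves_tso_game)
  then obtain d where d: "\<And>j. r (2 * j + 1) = ConfB (d j)" by metis
  show thesis
  proof (rule that[of c d])
    show "c 0 = c0" using c[of 0] assms(2) by simp
    fix j
    show "r (2 * j) = ConfA (c j)" "r (2 * j + 1) = ConfB (d j)" by (rule c, rule d)
    show "c j \<in> tso_confs P" "d j \<in> tso_confs P" "\<exists>i\<in>procs P. instr_step P i (c j) (d j)"
      using step[of "2 * j"] c[of j] d[of j] by (auto simp: moves_tso_game)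
    show "(update_step P)\<^sup>*\<^sup>* (d j) (c (Suc j))"
      using step[of "2 * j + 1"] c[of "Suc j"] d[of j] by (auto simp: moves_tso_game)
  qed
qed

lemma eventually_constant:
  fixes g :: "nat \<Rightarrow> nat"
  assumes "\<And>j. g (Suc j) \<le> g j"
  obtains M where "\<And>j. j \<ge> M \<Longrightarrow> g j = g M"
proof -
  have dec: "j \<ge> M \<Longrightarrow> g j \<le> g M" for j M
    by (induction rule: dec_induct) (auto intro: order_trans assms)
  obtain M where "\<And>j. g M \<le> g j" using ex_has_least_nat[of "\<lambda>_. True" 0 g] by auto
  with dec that show thesis by (metis antisym)
qed

text \<open>The measure \<open>\<mu> i\<close> yields fairness to process \<open>i\<close>: as long as \<open>i\<close> is not moved, it decreases whenever
  \<open>i\<close> is enabled.\<close>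

lemma A_wins_fromI:
  assumes wf: "wf_program P" and c0: "Inv c0" "c0 \<in> tso_confs P"
    and mv: "\<And>c. Inv c \<Longrightarrow> pl c \<in> procs P \<and> instr_step P (pl c) c (mv c)"
    and resp: "\<And>c c'. Inv c \<Longrightarrow> (update_step P)\<^sup>*\<^sup>* (mv c) c' \<Longrightarrow> Inv c'"
    and safe: "\<And>c i. Inv c \<Longrightarrow> i \<in> procs P \<Longrightarrow> loc c i \<notin> F"
    and fair: "\<And>c c' i. Inv c \<Longrightarrow> i \<in> procs P \<Longrightarrow> i \<noteq> pl c \<Longrightarrow> (update_step P)\<^sup>*\<^sup>* (mv c) c' \<Longrightarrow>
       \<mu> i c' < \<mu> i c \<or> \<not> instr_enabled P i c \<and> \<mu> i c' \<le> (\<mu> i c :: nat)"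
  shows "A_wins_from (tso_game P) (W_S P F \<inter> W_P P) (ConfA c0)"
proof -
  let ?G = "tso_game P"
  \<comment> \<open>A strategy has to be legal after every history, hence the arbitrary legal move
    outside the invariant.\<close>
  define \<sigma> where "\<sigma> h = (case last h of
      ConfA c \<Rightarrow> if Inv c then ConfB (mv c) else (SOME g. (ConfA c, g) \<in> moves ?G)
    | ConfB c \<Rightarrow> undefined)" for h :: "('a, 'b, 'c, 'd) tso_conf gconf list"
  have mvG: "(ConfA c, ConfB (mv c)) \<in> moves ?G" if "Inv c" "c \<in> tso_confs P" for c
    using mv[OF that(1)] instr_step_confs[OF wf _ that(2)] that(2) by (auto simp: moves_tso_game)
  have strat: "strategy ?G (confsA ?G) \<sigma>"
    unfolding strategy_def
  proof (intro allI impI, elim conjE)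
    fix h assume h: "last h \<in> confsA ?G" "\<not> dead ?G (last h)"
    then obtain c where c: "last h = ConfA c" "c \<in> tso_confs P" by (auto simp: tso_game_def)
    show "(last h, \<sigma> h) \<in> moves ?G"
    proof (cases "Inv c")
      case True
      then show ?thesis using mvG[OF True c(2)] c(1) by (simp add: \<sigma>_def)
    next
      case False
      have "\<exists>g. (ConfA c, g) \<in> moves ?G" using h(2) c(1) by (auto simp: dead_def)
      from someI_ex[OF this] show ?thesis using False c(1) by (simp add: \<sigma>_def)
    qed
  qed
  define J where "J g = (case g of ConfA c \<Rightarrow> Inv c \<and> c \<in> tso_confs P
    | ConfB d \<Rightarrow> d \<in> tso_confs P \<and> (\<exists>c. Inv c \<and> d = mv c))" for g
  have J_step: "J g'" if "J g" "(g, g') \<in> moves ?G" "\<And>c. g = ConfA c \<Longrightarrow> Inv c \<Longrightarrow> g' = ConfB (mv c)"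
    for g g'
    using that resp by (cases g) (auto simp: J_def moves_tso_game)
  have J0: "J (ConfA c0)" using c0 by (simp add: J_def)
  have "A_wins_play ?G (W_S P F \<inter> W_P P) \<pi>"
    if \<pi>: "is_play ?G \<pi>" "starts_in (ConfA c0) \<pi>" "follows (confsA ?G) \<sigma> \<pi>" for \<pi>
  proof (cases \<pi>)
    case (Fin h)
    with \<pi> have h: "h \<noteq> []" "h ! 0 = ConfA c0" "dead ?G (last h)"
      and st: "\<And>k. Suc k < length h \<Longrightarrow> (h ! k, h ! Suc k) \<in> moves ?G"
      by (auto simp: finite_path_def hd_conv_nth successively_conv_nth)
    have "k < length h \<Longrightarrow> J (h ! k)" for k
    proof (induction k)
      case (Suc k)
      show ?case
      proof (rule J_step)
        show "J (h ! k)" "(h ! k, h ! Suc k) \<in> moves ?G" using Suc st by simp_all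
        fix c assume "h ! k = ConfA c" "Inv c"
        then show "h ! Suc k = ConfB (mv c)"
          using \<pi>(3) Fin Suc \<open>J (h ! k)\<close>
          by (simp add: \<sigma>_def J_def take_Suc_conv_app_nth)
      qed
    qed (use h J0 in simp)
    then have "J (last h)" using h(1) by (simp add: last_conv_nth)
    then have "last h \<in> confsB ?G"
      using h(3) mvG by (auto simp: J_def dead_def split: gconf.splits)
    then show ?thesis using Fin by simp
  next
    case (Inf r)
    with \<pi> have r: "infinite_path ?G r" "r 0 = ConfA c0" by simp_all
    from infinite_path_alternates[OF r] obtain c d where cd:
      "c 0 = c0" "\<And>j. r (2 * j) = ConfA (c j)" "\<And>j. r (2 * j + 1) = ConfB (d j)"
      "\<And>j. c j \<in> tso_confs P" "\<And>j. d j \<in> tso_confs P"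
      "\<And>j. (update_step P)\<^sup>*\<^sup>* (d j) (c (Suc j))" by blast
    have d: "d j = mv (c j)" if "Inv (c j)" for j
    proof -
      have "r (Suc (2 * j)) = \<sigma> (map r [0..<Suc (2 * j)])"
        using \<pi>(3) Inf cd(2)[of j] cd(4)[of j] by simp
      then show ?thesis using cd(2)[of j] cd(3)[of j] that by (simp add: \<sigma>_def)
    qed
    have inv: "Inv (c j)" for j
    proof (induction j)
      case (Suc j)
      then show ?case using cd(6)[of j] d[OF Suc] resp by metis
    qed (use cd(1) c0 in simp)
    note d = d[OF inv]
    have r_cases: "r k \<in> {ConfA (c (k div 2)), ConfB (d (k div 2))}" for k
      using cd(2)[of "k div 2"] cd(3)[of "k div 2"] by (cases "even k") (auto elim: oddE)
    have "r k \<notin> confs_hitting P F" for k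
    proof -
      \<comment> \<open>The empty update sequence shows that the invariant holds right after the
        move too, so safety extends to the configurations of the update player.\<close>
      have "Inv (mv (c j))" for j using resp[OF inv] by blast
      then show ?thesis using r_cases[of k] inv safe by (auto simp: confs_hitting_def d)
    qed
    moreover have "infinite {k. \<exists>x y. r k = ConfA x \<and> r (Suc k) = ConfB y \<and> instr_step P i x y}"
      (is "infinite ?M") if i: "i \<in> procs P" and inf: "infinite {k. \<exists>x. r k = ConfA x \<and> instr_enabled P i x}"
      (is "infinite ?E") for i
    proof
      assume "finite ?M"
      then obtain J where J: "\<And>k. k \<in> ?M \<Longrightarrow> k < J" by (auto simp: finite_nat_set_iff_bounded)
      \<comment> \<open>\<open>J\<close> bounds positions of the play while \<open>j\<close> counts
        rounds; position \<open>2 * j\<close> is out of bounds as soon as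
        \<open>j \<ge> J\<close>.\<close>
      have pl: "i \<noteq> pl (c j)" if "j \<ge> J" for j
      proof
        assume "i = pl (c j)"
        then have "2 * j \<in> ?M" using mv[OF inv[of j]] cd(2)[of j] cd(3)[of j] d[of j] by auto
        from J[OF this] that show False by simp
      qed
      have fr: "\<mu> i (c (Suc j)) < \<mu> i (c j) \<or> \<not> instr_enabled P i (c j) \<and> \<mu> i (c (Suc j)) \<le> \<mu> i (c j)"
        if "j \<ge> J" for j
        using fair[OF inv i pl[OF that]] cd(6)[of j] d[of j] by simp
      have dec: "\<mu> i (c (J + Suc j)) \<le> \<mu> i (c (J + j))" for j using fr[of "J + j"] by auto
      obtain M where M: "\<And>j. j \<ge> M \<Longrightarrow> \<mu> i (c (J + j)) = \<mu> i (c (J + M))"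
        by (rule eventually_constant[of "\<lambda>j. \<mu> i (c (J + j))", OF dec]) blast
      have "k \<in> ?E \<Longrightarrow> k < 2 * (J + M)" for k
      proof (rule ccontr)
        assume k: "k \<in> ?E" "\<not> k < 2 * (J + M)"
        then have e: "instr_enabled P i (c (k div 2))" using r_cases[of k] by auto
        define j where "j = k div 2 - J"
        have "j \<ge> M" "k div 2 = J + j" using k(2) by (auto simp: j_def)
        then show False using fr[of "J + j"] e M[of j] M[of "Suc j"] by auto
      qed
      then have "finite ?E" unfolding finite_nat_set_iff_bounded by blast
      with inf show False by contradiction
    qed
    ultimately show ?thesis using r(1) Inf by (auto simp: W_S_def W_P_def)
  qed
  then show ?thesis using strat unfolding A_wins_from_def by blast
qed

text \<open>The rank can stay constant only while the process \<open>e\<close> is enabled and not moved, which is unfair.\<close>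

lemma not_A_wins_fromI:
  assumes wf: "wf_program P" and c0: "Good c0" "c0 \<in> tso_confs P" and e: "e \<in> procs P"
    and resp: "\<And>c c' i. Good c \<Longrightarrow> c \<in> tso_confs P \<Longrightarrow> i \<in> procs P \<Longrightarrow> instr_step P i c c' \<Longrightarrow>
       (\<exists>j\<in>procs P. loc c' j \<in> F) \<or>
       (\<exists>c''. (update_step P)\<^sup>*\<^sup>* c' c'' \<and> Good c'' \<and>
          (\<rho> c'' < (\<rho> c :: nat) \<or> c'' = c \<and> instr_enabled P e c \<and> \<not> instr_step P e c c'))"
  shows "\<not> A_wins_from (tso_game P) (W_S P F \<inter> W_P P) (ConfA c0)"
proof
  let ?G = "tso_game P"
  assume "A_wins_from ?G (W_S P F \<inter> W_P P) (ConfA c0)"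
  then obtain \<sigma>A where \<sigma>A: "strategy ?G (confsA ?G) \<sigma>A"
    and win: "\<And>\<sigma>B \<pi>. \<lbrakk>strategy ?G (confsB ?G) \<sigma>B; is_play ?G \<pi>; starts_in (ConfA c0) \<pi>;
       follows (confsA ?G) \<sigma>A \<pi>; follows (confsB ?G) \<sigma>B \<pi>\<rbrakk> \<Longrightarrow> A_wins_play ?G (W_S P F \<inter> W_P P) \<pi>"
    unfolding A_wins_from_def by blast
  define R where "R c c' c'' \<longleftrightarrow> (update_step P)\<^sup>*\<^sup>* c' c'' \<and> Good c'' \<and>
     (\<rho> c'' < \<rho> c \<or> c'' = c \<and> instr_enabled P e c \<and> \<not> instr_step P e c c')" for c c' c''
  define \<beta> where "\<beta> c c' = (if \<exists>c''. R c c' c'' then SOME c''. R c c' c'' else c')" for c c'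
  have \<beta>_R: "R c c' (\<beta> c c')" if "\<exists>c''. R c c' c''" for c c'
    using someI_ex[OF that] that by (simp add: \<beta>_def)
  have \<beta>_upd: "(update_step P)\<^sup>*\<^sup>* c' (\<beta> c c')" for c c'
  proof (cases "\<exists>c''. R c c' c''")
    case True
    then show ?thesis using \<beta>_R[OF True] by (simp only: R_def)
  qed (simp add: \<beta>_def)
  \<comment> \<open>The response depends on the configuration before the last move, which is found
    in the history. Every branch for a \<open>ConfB\<close> is legal, even after a history of length
    one, because \<open>\<beta> c c'\<close> is reached from \<open>c'\<close> by updates whatever
    \<open>c\<close> is.\<close>
  define \<sigma>B where "\<sigma>B h = (case last h of
      ConfB c' \<Rightarrow> (case last (butlast h) of ConfA c \<Rightarrow> ConfA (\<beta> c c') | ConfB _ \<Rightarrow> ConfA c')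
    | ConfA _ \<Rightarrow> undefined)" for h
  have \<sigma>B: "strategy ?G (confsB ?G) \<sigma>B"
    unfolding strategy_def
  proof (intro allI impI, elim conjE)
    fix h assume "last h \<in> confsB ?G"
    then obtain c' where c': "last h = ConfB c'" "c' \<in> tso_confs P" by (auto simp: tso_game_def)
    then show "(last h, \<sigma>B h) \<in> moves ?G"
      using \<beta>_upd updates_confs[OF \<beta>_upd c'(2)]
      by (auto simp: \<sigma>B_def moves_tso_game split: gconf.split)
  qed
  obtain \<pi> where \<pi>: "is_play ?G \<pi>" "starts_in (ConfA c0) \<pi>" "follows (confsA ?G) \<sigma>A \<pi>"
    "follows (confsB ?G) \<sigma>B \<pi>"
  proof (rule exE[OF play_exists[OF _ _ _ \<sigma>A \<sigma>B]])
    show "confsA ?G \<inter> confsB ?G = {}"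
      "moves ?G \<subseteq> (confsA ?G \<union> confsB ?G) \<times> (confsA ?G \<union> confsB ?G)"
      by (auto simp: tso_game_def)
  qed (use c0 in auto)
  from win[OF \<sigma>B \<pi>] have w: "A_wins_play ?G (W_S P F \<inter> W_P P) \<pi>" .
  show False
  proof (cases \<pi>)
    case (Fin h)
    then obtain c where "last h = ConfB c" "c \<in> tso_confs P" using w by (auto simp: tso_game_def)
    then show False using B_not_dead \<pi>(1) Fin by fastforce
  next
    case (Inf r)
    with w \<pi> have r: "infinite_path ?G r" "r 0 = ConfA c0" and WS: "\<And>k. r k \<notin> confs_hitting P F"
      and WP: "r \<in> W_P P"
      by (auto simp: W_S_def)
    from infinite_path_alternates[OF r] obtain c d where cd:
      "c 0 = c0" "\<And>j. r (2 * j) = ConfA (c j)" "\<And>j. r (2 * j + 1) = ConfB (d j)"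
      "\<And>j. c j \<in> tso_confs P" "\<And>j. d j \<in> tso_confs P"
      "\<And>j. \<exists>i\<in>procs P. instr_step P i (c j) (d j)" by blast
    have c_Suc: "c (Suc j) = \<beta> (c j) (d j)" for j
    proof -
      have "r (Suc (2 * j + 1)) = \<sigma>B (map r [0..<Suc (2 * j + 1)])"
        using \<pi>(4) Inf cd(3)[of j] cd(5)[of j] by simp
      then show ?thesis using cd(2)[of j] cd(3)[of j] cd(2)[of "Suc j"]
        by (simp add: \<sigma>B_def butlast_append)
    qed
    have step: "R (c j) (d j) (c (Suc j))" if "Good (c j)" for j
    proof -
      from cd(6)[of j] obtain i where i: "i \<in> procs P" "instr_step P i (c j) (d j)" by blast
      have "\<not> (\<exists>j'\<in>procs P. loc (d j) j' \<in> F)"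
        using WS[of "2 * j + 1"] cd(3,5)[of j] by (auto simp: confs_hitting_def)
      with resp[OF that cd(4) i] have "\<exists>c''. R (c j) (d j) c''" by (simp add: R_def)
      then show ?thesis using \<beta>_R c_Suc by metis
    qed
    have good: "Good (c j)" for j
    proof (induction j)
      case (Suc j)
      then show ?case using step[OF Suc] by (simp add: R_def)
    qed (use cd(1) c0 in simp)
    note step = step[OF good, unfolded R_def]
    have dec: "\<rho> (c (Suc j)) \<le> \<rho> (c j)" for j using step[of j] by auto
    obtain M where M: "\<And>j. j \<ge> M \<Longrightarrow> \<rho> (c j) = \<rho> (c M)"
      by (rule eventually_constant[of "\<lambda>j. \<rho> (c j)", OF dec]) blast
    have idle: "instr_enabled P e (c j) \<and> \<not> instr_step P e (c j) (d j)" if "j \<ge> M" for j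
      using step[of j] M[OF that] M[of "Suc j"] that by auto
    have "infinite {k. \<exists>x. r k = ConfA x \<and> instr_enabled P e x}"
    proof (rule infinite_super)
      show "(\<lambda>j. 2 * j) ` {M..} \<subseteq> {k. \<exists>x. r k = ConfA x \<and> instr_enabled P e x}"
        using idle cd(2) by auto
      show "infinite ((\<lambda>j. 2 * j) ` {M..})"
        by (simp add: finite_image_iff inj_on_def infinite_Ici)
    qed
    with WP e have "infinite {k. \<exists>x y. r k = ConfA x \<and> r (Suc k) = ConfB y \<and> instr_step P e x y}"
      by (auto simp: W_P_def)
    moreover have "{k. \<exists>x y. r k = ConfA x \<and> r (Suc k) = ConfB y \<and> instr_step P e x y} \<subseteq> {..<2 * M}"
    proof (intro subsetI CollectI, elim CollectE exE conjE)
      fix k x y assume k: "r k = ConfA x" "r (Suc k) = ConfB y" "instr_step P e x y"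
      then have "even k" using cd(3) by (metis gconf.distinct(1) oddE)
      then obtain j where j: "k = 2 * j" by (auto elim: evenE)
      then have "x = c j" "y = d j" using k cd(2,3)[of j] by simp_all
      then have "j < M" using idle[of j] k(3) by (meson not_le)
      then show "k \<in> {..<2 * M}" using j by simp
    qed
    ultimately show False using finite_subset by blast
  qed
qed


section \<open>The gadget program\<close>

text \<open>The states of the control process are \<open>Await q p\<close> (machine state \<open>q\<close>, next symbol expected on
  variable \<open>p\<close>), the four phases \<open>Reset\<close> to \<open>Check\<close> of a step to machine state \<open>q\<close> that appends \<open>w\<close>,
  and \<open>Sink\<close>. In \<open>Writer w p r\<close> the word \<open>w\<close> remains to be written, starting on variable \<open>r\<close>, and
  \<open>p\<close> is the parity of the next announcement.\<close>

datatype local_state =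
    Await nat bool
  | Reset nat "nat list" bool
  | Announce nat "nat list" bool
  | Fence nat "nat list" bool
  | Check nat "nat list" bool
  | Sink
  | Writer "nat list" bool bool

instance local_state :: countable
  by countable_datatype

text \<open>Variables 0 and 1 carry the queue, with value 0 for unset; variable 2 carries the announcements.\<close>

definition xv :: "bool \<Rightarrow> nat" where
  "xv b = of_bool b"

text \<open>The bit tells a new announcement from the one before it even if both carry the same
  word, so the writer takes each of them once.\<close>

definition yv :: "nat list \<Rightarrow> bool \<Rightarrow> nat" where
  "yv w b = to_nat (w, b)"

lemma xv_simps [simp]: "xv b = xv b' \<longleftrightarrow> b = b'" "xv b \<noteq> 2" "2 \<noteq> xv b" "xv b < 3"
  by (simp_all add: xv_def)

lemma yv_eq [simp]: "yv w b = yv w' b' \<longleftrightarrow> w = w' \<and> b = b'"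
  by (simp add: yv_def)

definition words :: "nat list set" where
  "words = {w. set w \<subseteq> {1, 2, 3} \<and> length w \<le> 2}"

lemma finite_words: "finite words"
  unfolding words_def by (rule finite_lists_length_le) simp

lemma words_Cons: "a # w \<in> words \<Longrightarrow> a \<in> {1, 2, 3} \<and> w \<in> words"
  by (auto simp: words_def)

lemma length_words: "w \<in> words \<Longrightarrow> length w \<le> 2"
  by (simp add: words_def)

lemma Nil_words [simp]: "[] \<in> words"
  by (simp add: words_def)

text \<open>Here the oldest message comes first; in a buffer it comes last, so the buffers hold
  \<open>rev (msgs b u)\<close>.\<close>

fun msgs :: "bool \<Rightarrow> nat list \<Rightarrow> (nat \<times> nat) list" where
  "msgs b [] = []"
| "msgs b (a # u) = (xv b, a) # msgs (\<not> b) u"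

text \<open>The variable on which the message after \<open>msgs b u\<close> has to be
  written.\<close>

definition par :: "bool \<Rightarrow> nat list \<Rightarrow> bool" where
  "par b u \<longleftrightarrow> (b \<noteq> odd (length u))"

lemma par_simps [simp]:
  "par b [] = b" "par b (a # u) = par (\<not> b) u" "par b (u @ [a]) = (\<not> par b u)"
  by (auto simp: par_def)

lemma msgs_snoc: "msgs b (u @ [a]) = msgs b u @ [(xv (par b u), a)]"
  by (induction u arbitrary: b) auto

lemma rev_msgs_snoc [simp]: "rev (msgs b (u @ [a])) = (xv (par b u), a) # rev (msgs b u)"
  by (simp add: msgs_snoc)

lemma rev_msgs_eq_snoc:
  "rev (msgs b u) = w @ [(x, d)] \<longleftrightarrow> (\<exists>v. u = d # v \<and> x = xv b \<and> w = rev (msgs (\<not> b) v))"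
  by (cases u) auto

section \<open>Guards and effects of TSO instructions\<close>

inductive enabled_in :: "('i, 'q, 'x, 'v) tso_conf \<Rightarrow> 'i \<Rightarrow> ('x, 'v) instr \<Rightarrow> bool" for c i where
  "map_of (buf c i) x = Some d \<or> map_of (buf c i) x = None \<and> mem c x = d \<Longrightarrow> enabled_in c i (Rd x d)"
| "enabled_in c i (Wr x d)"
| "enabled_in c i Skip"
| "buf c i = [] \<Longrightarrow> enabled_in c i Mf"

fun effect :: "'i \<Rightarrow> ('x, 'v) instr \<Rightarrow> 'q \<Rightarrow> ('i, 'q, 'x, 'v) tso_conf \<Rightarrow> ('i, 'q, 'x, 'v) tso_conf" where
  "effect i (Wr x d) q c = c\<lparr>loc := (loc c)(i := q), buf := (buf c)(i := (x, d) # buf c i)\<rparr>"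
| "effect i _ q c = c\<lparr>loc := (loc c)(i := q)\<rparr>"

lemma instr_step_iff:
  "instr_step P i c c' \<longleftrightarrow> (\<exists>a q. (loc c i, a, q) \<in> trans P i \<and> enabled_in c i a \<and> c' = effect i a q c)"
proof
  assume "instr_step P i c c'"
  then show "\<exists>a q. (loc c i, a, q) \<in> trans P i \<and> enabled_in c i a \<and> c' = effect i a q c"
    by cases (force intro: enabled_in.intros)+
next
  assume "\<exists>a q. (loc c i, a, q) \<in> trans P i \<and> enabled_in c i a \<and> c' = effect i a q c"
  then obtain a q where t: "(loc c i, a, q) \<in> trans P i" and e: "enabled_in c i a"
    and c': "c' = effect i a q c" by blast
  from e show "instr_step P i c c'"
    by cases (use t c' in \<open>auto intro: instr_step.intros\<close>)
qed

inductive writes :: "local_state \<Rightarrow> (nat, nat) instr \<Rightarrow> local_state \<Rightarrow> bool" where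
  "w \<in> words \<Longrightarrow> writes (Writer [] p r) (Rd 2 (yv w p)) (Writer w (\<not> p) r)"
| "w \<in> words \<Longrightarrow> writes (Writer [] p r) (Rd 2 (yv w (\<not> p))) (Writer [] p r)"
| "a # w \<in> words \<Longrightarrow> writes (Writer (a # w) p r) (Wr (xv r) a) (Writer w p (\<not> r))"

text \<open>The fence precedes the check so that no reset is pending afterwards; a delayed one could
  erase a symbol delivered later on the same variable.\<close>

inductive controls :: "(nat \<Rightarrow> nat \<Rightarrow> nat list \<times> nat) \<Rightarrow> nat \<Rightarrow> local_state \<Rightarrow> (nat, nat) instr \<Rightarrow> local_state \<Rightarrow> bool"
  for \<delta> N where
  "0 < q \<Longrightarrow> q < N \<Longrightarrow> a \<in> {1, 2, 3} \<Longrightarrow> \<delta> q a = (w, q') \<Longrightarrow>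
     controls \<delta> N (Await q p) (Rd (xv p) a) (Reset q' w p)"
| "q < N \<Longrightarrow> w \<in> words \<Longrightarrow> controls \<delta> N (Reset q w p) (Wr (xv p) 0) (Announce q w p)"
| "q < N \<Longrightarrow> w \<in> words \<Longrightarrow> controls \<delta> N (Announce q w p) (Wr 2 (yv w p)) (Fence q w p)"
| "q < N \<Longrightarrow> w \<in> words \<Longrightarrow> controls \<delta> N (Fence q w p) Mf (Check q w p)"
| "q < N \<Longrightarrow> w \<in> words \<Longrightarrow> controls \<delta> N (Check q w p) (Rd (xv (\<not> p)) 0) (Await q (\<not> p))"
| "q < N \<Longrightarrow> w \<in> words \<Longrightarrow> a \<in> {1, 2, 3} \<Longrightarrow> controls \<delta> N (Check q w p) (Rd (xv (\<not> p)) a) Sink"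

definition targets :: "nat set" where
  "targets = {to_nat (Await 0 False), to_nat (Await 0 True)}"

text \<open>Process 0 is the control process, process 1 the writer.\<close>

definition view where
  "view c s t b0 b1 f y \<longleftrightarrow> loc c 0 = to_nat (s :: local_state) \<and> loc c 1 = to_nat (t :: local_state) \<and>
     buf c 0 = b0 \<and> buf c 1 = b1 \<and> (\<forall>b. mem c (xv b) = f b) \<and> mem c 2 = y"
  for c :: "(nat, nat, nat, nat) tso_conf"

lemma view_unique: "view c s t b0 b1 f y \<Longrightarrow> view c s' t' b0' b1' f' y' \<Longrightarrow> s = s' \<and> t = t'"
  by (simp add: view_def)

text \<open>The writer's buffer contains symbols on queue variables only. Hence its reads of
  variable 2 see the memory, and each of its updates makes a variable nonzero.\<close>

definition valid :: "(nat \<times> nat) list \<Rightarrow> (bool \<Rightarrow> nat) \<Rightarrow> bool" where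
  "valid b1 f \<longleftrightarrow> set b1 \<subseteq> range xv \<times> {1, 2, 3} \<and> (\<forall>b. f b \<in> {0, 1, 2, 3})"

lemma valid_no_y: "valid b1 f \<Longrightarrow> map_of b1 2 = None"
  by (auto simp: valid_def map_of_eq_None_iff)

locale gadget =
  fixes \<delta> :: "nat \<Rightarrow> nat \<Rightarrow> nat list \<times> nat" and N :: nat and P :: "(nat, nat, nat, nat) program"
  assumes \<delta>_bounds: "\<lbrakk>\<delta> q a = (w, q'); 0 < q; q < N; a \<in> {1, 2, 3}\<rbrakk> \<Longrightarrow> w \<in> words \<and> q' < N"
    and wf: "wf_program P"
    and procs: "procs P = {0, 1}"
    and trans0: "trans P 0 = {(to_nat s, a, to_nat t) | s a t. controls \<delta> N s a t}"
    and trans1: "trans P 1 = {(to_nat s, a, to_nat t) | s a t. writes s a t}"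
begin

section \<open>Single steps and updates of the gadget\<close>

lemma control_step_iff:
  "view c s t b0 b1 f y \<Longrightarrow> instr_step P 0 c c' \<longleftrightarrow>
     (\<exists>a s'. controls \<delta> N s a s' \<and> enabled_in c 0 a \<and> c' = effect 0 a (to_nat s') c)"
  by (auto simp: instr_step_iff trans0 view_def)

lemma writer_step_iff:
  "view c s t b0 b1 f y \<Longrightarrow> instr_step P 1 c c' \<longleftrightarrow>
     (\<exists>a t'. writes t a t' \<and> enabled_in c 1 a \<and> c' = effect 1 a (to_nat t') c)"
  unfolding instr_step_iff trans1 by (auto simp: view_def)


lemma control_view:
  assumes "view c s t b0 b1 f y" "controls \<delta> N s a s'"
  shows "view (effect 0 a (to_nat s') c) s' t (case a of Wr x d \<Rightarrow> (x, d) # b0 | _ \<Rightarrow> b0) b1 f y"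
  using assms by (cases a) (auto simp: view_def)

lemma writer_view:
  assumes "view c s t b0 b1 f y" "writes t a t'"
  shows "view (effect 1 a (to_nat t') c) s t' b0 (case a of Wr x d \<Rightarrow> (x, d) # b1 | _ \<Rightarrow> b1) f y"
  using assms by (cases a) (auto simp: view_def)

lemma enabled_control_read:
  "view c s t [] b1 f y \<Longrightarrow> enabled_in c 0 (Rd (xv p) a) \<longleftrightarrow> f p = a"
  by (auto simp: view_def enabled_in.simps)

lemma enabled_control_fence: "view c s t b0 b1 f y \<Longrightarrow> enabled_in c 0 Mf \<longleftrightarrow> b0 = []"
  by (auto simp: view_def enabled_in.simps)

lemma enabled_write [simp]: "enabled_in c i (Wr x d)"
  by (simp add: enabled_in.simps)

lemma enabled_writer_read:
  "view c s t b0 b1 f y \<Longrightarrow> valid b1 f \<Longrightarrow> enabled_in c 1 (Rd 2 d) \<longleftrightarrow> y = d"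
  using valid_no_y by (auto simp: view_def enabled_in.simps)

lemma await_step:
  assumes v: "view c (Await q p) t [] b1 f y" and st: "instr_step P 0 c c'"
  shows "0 < q \<and> q < N \<and> f p \<in> {1, 2, 3} \<and>
    (\<exists>w q'. \<delta> q (f p) = (w, q') \<and> w \<in> words \<and> q' < N \<and> view c' (Reset q' w p) t [] b1 f y)"
proof -
  from st obtain a s' where a: "controls \<delta> N (Await q p) a s'" "enabled_in c 0 a" "c' = effect 0 a (to_nat s') c"
    using control_step_iff[OF v] by blast
  from a(1) show ?thesis
  proof cases
    case (1 d w q')
    then have "f p = d" using a(2) enabled_control_read[OF v] by simp
    moreover have "view c' (Reset q' w p) t [] b1 f y" using control_view[OF v a(1)] a(3) 1 by simp
    ultimately show ?thesis using 1 \<delta>_bounds[OF 1(6,3,4,5)] by blast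
  qed
qed

lemma await_enabled:
  assumes v: "view c (Await q p) t [] b1 f y" and "0 < q" "q < N" "f p \<in> {1, 2, 3}"
  shows "instr_enabled P 0 c"
  using assms(2-) controls.intros(1)[of q N "f p" \<delta>] enabled_control_read[OF v, of p]
  unfolding instr_enabled_def control_step_iff[OF v] by (metis surj_pair)

lemma await_disabled: "view c (Await q p) t [] b1 f y \<Longrightarrow> f p = 0 \<Longrightarrow> \<not> instr_enabled P 0 c"
  using await_step unfolding instr_enabled_def by fastforce

lemma reset_step:
  assumes v: "view c (Reset q w p) t b0 b1 f y" and st: "instr_step P 0 c c'"
  shows "view c' (Announce q w p) t ((xv p, 0) # b0) b1 f y"
proof -
  from st obtain a s' where a: "controls \<delta> N (Reset q w p) a s'" "enabled_in c 0 a" "c' = effect 0 a (to_nat s') c"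
    using control_step_iff[OF v] by blast
  from a(1) show ?thesis by cases (use a(3) control_view[OF v a(1)] in simp)
qed

lemma reset_enabled:
  assumes v: "view c (Reset q w p) t b0 b1 f y" and "q < N" "w \<in> words"
  shows "instr_enabled P 0 c"
  using assms(2-) controls.intros(2) unfolding instr_enabled_def control_step_iff[OF v] by fastforce

lemma announce_step:
  assumes v: "view c (Announce q w p) t b0 b1 f y" and st: "instr_step P 0 c c'"
  shows "view c' (Fence q w p) t ((2, yv w p) # b0) b1 f y"
proof -
  from st obtain a s' where a: "controls \<delta> N (Announce q w p) a s'" "enabled_in c 0 a" "c' = effect 0 a (to_nat s') c"
    using control_step_iff[OF v] by blast
  from a(1) show ?thesis by cases (use a(3) control_view[OF v a(1)] in simp)
qed

lemma announce_enabled: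
  assumes v: "view c (Announce q w p) t b0 b1 f y" and "q < N" "w \<in> words"
  shows "instr_enabled P 0 c"
  using assms(2-) controls.intros(3) unfolding instr_enabled_def control_step_iff[OF v] by fastforce

lemma fence_step:
  assumes v: "view c (Fence q w p) t b0 b1 f y" and st: "instr_step P 0 c c'"
  shows "b0 = [] \<and> view c' (Check q w p) t [] b1 f y"
proof -
  from st obtain a s' where a: "controls \<delta> N (Fence q w p) a s'" "enabled_in c 0 a" "c' = effect 0 a (to_nat s') c"
    using control_step_iff[OF v] by blast
  from a(1) show ?thesis
    by cases (use a(2,3) control_view[OF v a(1)] enabled_control_fence[OF v] in auto)
qed

lemma fence_enabled:
  assumes v: "view c (Fence q w p) t [] b1 f y" and "q < N" "w \<in> words"
  shows "instr_enabled P 0 c"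
  using assms(2-) controls.intros(4) enabled_control_fence[OF v]
  unfolding instr_enabled_def control_step_iff[OF v] by fastforce

lemma check_step:
  assumes v: "view c (Check q w p) t [] b1 f y" and st: "instr_step P 0 c c'"
  shows "f (\<not> p) = 0 \<and> view c' (Await q (\<not> p)) t [] b1 f y \<or> f (\<not> p) \<noteq> 0 \<and> view c' Sink t [] b1 f y"
proof -
  from st obtain a s' where a: "controls \<delta> N (Check q w p) a s'" "enabled_in c 0 a" "c' = effect 0 a (to_nat s') c"
    using control_step_iff[OF v] by blast
  from a(1) show ?thesis
    by cases (use a(2,3) control_view[OF v a(1)] enabled_control_read[OF v] in auto)
qed

lemma check_enabled:
  assumes v: "view c (Check q w p) t [] b1 f y" and "q < N" "w \<in> words" "f (\<not> p) \<in> {0, 1, 2, 3}"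
  shows "instr_enabled P 0 c"
proof -
  have e: "enabled_in c 0 (Rd (xv (\<not> p)) (f (\<not> p)))" using enabled_control_read[OF v] by simp
  show ?thesis
  proof (cases "f (\<not> p) = 0")
    case True
    then show ?thesis using controls.intros(5)[of q N w \<delta> p] assms(2,3) e
      unfolding instr_enabled_def control_step_iff[OF v] by metis
  next
    case False
    then have "f (\<not> p) \<in> {1, 2, 3}" using assms(4) by simp
    then show ?thesis using controls.intros(6)[of q N w "f (\<not> p)" \<delta> p] assms(2,3) e
      unfolding instr_enabled_def control_step_iff[OF v] by metis
  qed
qed

lemma sink_disabled:
  assumes v: "view c Sink t b0 b1 f y"
  shows "\<not> instr_enabled P 0 c"
  unfolding instr_enabled_def control_step_iff[OF v] by (auto elim: controls.cases)

text \<open>Fairness credits a move to every process that could have made it. A spin of the writer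
  leaves the configuration unchanged, and it cannot pass for a control step because each control
  transition changes the local state.\<close>

lemma control_no_self_step:
  assumes v: "view c s t b0 b1 f y"
  shows "\<not> instr_step P 0 c c"
proof
  assume "instr_step P 0 c c"
  then obtain a s' where a: "controls \<delta> N s a s'" "c = effect 0 a (to_nat s') c"
    using control_step_iff[OF v] by blast
  with control_view[OF v a(1)] have "s = s'" using view_unique[OF v] by metis
  with a(1) show False by (auto elim: controls.cases)
qed

lemma writer_read_step:
  assumes v: "view c s (Writer [] p r) b0 b1 f (yv w p')" and "valid b1 f" and st: "instr_step P 1 c c'"
  shows "p' = p \<and> view c' s (Writer w (\<not> p) r) b0 b1 f (yv w p') \<or> p' \<noteq> p \<and> c' = c"
proof -
  from st obtain a t' where a: "writes (Writer [] p r) a t'" "enabled_in c 1 a" "c' = effect 1 a (to_nat t') c"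
    using writer_step_iff[OF v] by blast
  have "to_nat (Writer [] p r) = loc c 1" using v by (simp add: view_def)
  with a show ?thesis
    by cases (use a(2,3) writer_view[OF v a(1)] enabled_writer_read[OF v assms(2)] in auto)
qed

lemma writer_read_enabled:
  assumes v: "view c s (Writer [] p r) b0 b1 f (yv w p')" and "valid b1 f" "w \<in> words"
  shows "instr_enabled P 1 c"
  using writes.intros(1)[OF assms(3), of p r] writes.intros(2)[OF assms(3), of p r]
    enabled_writer_read[OF v assms(2)]
  unfolding instr_enabled_def writer_step_iff[OF v] by (cases "p' = p") fastforce+

lemma writer_write_step:
  assumes v: "view c s (Writer (a # w) p r) b0 b1 f y" and st: "instr_step P 1 c c'"
  shows "a # w \<in> words \<and> view c' s (Writer w p (\<not> r)) b0 ((xv r, a) # b1) f y"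
proof -
  from st obtain i t' where a: "writes (Writer (a # w) p r) i t'" "enabled_in c 1 i" "c' = effect 1 i (to_nat t') c"
    using writer_step_iff[OF v] by blast
  from a(1) show ?thesis by cases (use a(3) writer_view[OF v a(1)] in simp_all)
qed

lemma writer_write_enabled:
  assumes v: "view c s (Writer (a # w) p r) b0 b1 f y" and "a # w \<in> words"
  shows "instr_enabled P 1 c"
  using writes.intros(3)[OF assms(2)] unfolding instr_enabled_def writer_step_iff[OF v] by fastforce

lemma update_view:
  assumes v: "view c s t b0 b1 f y" and u: "update_step P c c'"
  shows "(\<exists>w x d. b0 = w @ [(x, d)] \<and>
      view c' s t w b1 (\<lambda>b. if xv b = x then d else f b) (if x = 2 then d else y)) \<or>
    (\<exists>w x d. b1 = w @ [(x, d)] \<and>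
      view c' s t b0 w (\<lambda>b. if xv b = x then d else f b) (if x = 2 then d else y))"
  using u by cases (use v in \<open>auto simp: view_def procs\<close>)

lemma update0:
  assumes "view c s t (w @ [(x, d)]) b1 f y"
  shows "\<exists>c'. update_step P c c' \<and>
    view c' s t w b1 (\<lambda>b. if xv b = x then d else f b) (if x = 2 then d else y)"
  by (rule exI, rule conjI, rule update_step.intros[of 0])
    (use assms in \<open>auto simp: view_def procs\<close>)

lemma update1:
  assumes "view c s t b0 (w @ [(x, d)]) f y"
  shows "\<exists>c'. update_step P c c' \<and>
    view c' s t b0 w (\<lambda>b. if xv b = x then d else f b) (if x = 2 then d else y)"
  by (rule exI, rule conjI, rule update_step.intros[of 1])
    (use assms in \<open>auto simp: view_def procs\<close>)

end


section \<open>The process player wins if the machine runs forever\<close>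

text \<open>The queue is \<open>u\<close>, whose first symbol may already be delivered, unless the update player has cheated,
  which shows in \<open>f (\<not> p) \<noteq> 0\<close>.\<close>

definition content :: "(bool \<Rightarrow> nat) \<Rightarrow> bool \<Rightarrow> (nat \<times> nat) list \<Rightarrow> bool \<Rightarrow> nat list \<Rightarrow> bool" where
  "content f p b1 r u \<longleftrightarrow> f (\<not> p) \<noteq> 0
     \<or> f p = 0 \<and> b1 = rev (msgs p u) \<and> r = par p u
     \<or> (\<exists>v. u = f p # v \<and> f p \<noteq> 0 \<and> b1 = rev (msgs (\<not> p) v) \<and> r = par (\<not> p) v)"

text \<open>The machine step in progress leads to state \<open>q\<close> and appends
  \<open>w\<close>; \<open>v\<close> is the queue without the symbol read. The value
  \<open>f p\<close> is left open, since it depends on whether the reset has arrived.\<close>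

definition replying where
  "replying reach N f p b1 r q w \<longleftrightarrow> valid b1 f \<and> q < N \<and> w \<in> words \<and>
     (f (\<not> p) = 0 \<longrightarrow> (\<exists>v. b1 = rev (msgs (\<not> p) v) \<and> r = par (\<not> p) v \<and> reach (q, v @ w)))"
  for reach :: "nat \<times> nat list \<Rightarrow> bool" and N :: nat

text \<open>Once the reset has reached the memory, \<open>p\<close> can be set again only after a
  symbol has arrived on the other variable, because the messages alternate.\<close>

abbreviation (input) clear :: "(bool \<Rightarrow> nat) \<Rightarrow> bool \<Rightarrow> bool" where
  "clear f p \<equiv> f (\<not> p) = 0 \<longrightarrow> f p = 0"

text \<open>Under the strategy the writer has emptied its word before the control process leaves
  \<open>Await\<close>, and it takes the new announcement only when the control process is back
  there. In the sink only well-formedness remains.\<close>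

inductive A_invariant for reach :: "nat \<times> nat list \<Rightarrow> bool" and N :: nat where
  read: "\<lbrakk>valid b1 f; content f p b1 r u; reach (q, u @ w); w \<in> words; w' \<in> words\<rbrakk> \<Longrightarrow>
    A_invariant reach N (Await q p) (Writer w p r) [] b1 f (yv w' (\<not> p))"
| unread: "\<lbrakk>valid b1 f; content f p b1 r u; reach (q, u @ w); w \<in> words\<rbrakk> \<Longrightarrow>
    A_invariant reach N (Await q p) (Writer [] (\<not> p) r) [] b1 f (yv w (\<not> p))"
| reset: "\<lbrakk>replying reach N f p b1 r q w; w' \<in> words\<rbrakk> \<Longrightarrow>
    A_invariant reach N (Reset q w p) (Writer [] p r) [] b1 f (yv w' (\<not> p))"
| announce: "\<lbrakk>replying reach N f p b1 r q w; w' \<in> words; b0 = [(xv p, 0)] \<or> b0 = [] \<and> clear f p\<rbrakk> \<Longrightarrow>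
    A_invariant reach N (Announce q w p) (Writer [] p r) b0 b1 f (yv w' (\<not> p))"
| fence: "\<lbrakk>replying reach N f p b1 r q w; w' \<in> words;
      b0 = [(2, yv w p), (xv p, 0)] \<or> b0 = [(2, yv w p)] \<and> clear f p\<rbrakk> \<Longrightarrow>
    A_invariant reach N (Fence q w p) (Writer [] p r) b0 b1 f (yv w' (\<not> p))"
| fenced: "\<lbrakk>replying reach N f p b1 r q w; clear f p; s = Fence q w p \<or> s = Check q w p\<rbrakk> \<Longrightarrow>
    A_invariant reach N s (Writer [] p r) [] b1 f (yv w p)"
| sink: "\<lbrakk>valid b1 f; w \<in> words; w' \<in> words\<rbrakk> \<Longrightarrow>
    A_invariant reach N Sink (Writer w p r) [] b1 f (yv w' p')"

section \<open>Effect of updates on the invariant\<close>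

lemma valid_snoc:
  assumes "valid (b1 @ [(x, d)]) f"
  shows "\<exists>b. x = xv b \<and> d \<in> {1, 2, 3}" "valid b1 (\<lambda>b. if xv b = x then d else f b)"
  using assms by (auto simp: valid_def)

lemma valid_Cons: "valid b1 f \<Longrightarrow> a \<in> {1, 2, 3} \<Longrightarrow> valid ((xv r, a) # b1) f"
  by (auto simp: valid_def)

lemma valid_clear: "valid b1 f \<Longrightarrow> valid b1 (\<lambda>b. if b = p then 0 else f b)"
  by (auto simp: valid_def)

lemma valid_range: "valid b1 f \<Longrightarrow> f b \<in> {0, 1, 2, 3}"
  by (auto simp: valid_def)

lemma content_write:
  "content f p b1 r u \<Longrightarrow> content f p ((xv r, a) # b1) (\<not> r) (u @ [a])"
  unfolding content_def
  using rev_msgs_snoc by (elim disjE exE conjE) (auto simp: msgs_snoc)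

text \<open>Unless cheating already shows, the oldest message is on \<open>p\<close> if
  \<open>f p = 0\<close>, which delivers the front symbol, and on the other variable otherwise,
  which shows as cheating.\<close>

lemma content_update:
  assumes "valid (b1 @ [(x, d)]) f" "content f p (b1 @ [(x, d)]) r u"
  shows "content (\<lambda>b. if xv b = x then d else f b) p b1 r u"
proof -
  obtain b where b: "x = xv b" "d \<noteq> 0" using valid_snoc(1)[OF assms(1)] by auto
  show ?thesis using assms(2) b
    by (cases "b = p") (auto simp: content_def eq_commute[of "b1 @ _"] rev_msgs_eq_snoc)
qed

text \<open>During a reply without cheating the oldest message is on the variable other than
  \<open>p\<close>. After its delivery that variable is nonzero and the conditional claims hold
  vacuously.\<close>

lemma replying_update:
  assumes "replying reach N f p (b1 @ [(x, d)]) r q w"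
  shows "replying reach N (\<lambda>b. if xv b = x then d else f b) p b1 r q w"
    "clear f p \<Longrightarrow> clear (\<lambda>b. if xv b = x then d else f b) p" "x \<noteq> 2"
proof -
  obtain b where b: "x = xv b" "d \<noteq> 0" using valid_snoc(1)[of b1 x d f] assms by (auto simp: replying_def)
  show "replying reach N (\<lambda>b. if xv b = x then d else f b) p b1 r q w" using assms b valid_snoc(2)[of b1 x d f]
    by (cases "b = p") (auto simp: replying_def eq_commute[of "b1 @ _"] rev_msgs_eq_snoc)
  show "clear (\<lambda>b. if xv b = x then d else f b) p" if "clear f p" using assms b that
    by (cases "b = p") (auto simp: replying_def eq_commute[of "b1 @ _"] rev_msgs_eq_snoc)
  show "x \<noteq> 2" using b by simp
qed

lemma replying_clear: "replying reach N f p b1 r q w \<Longrightarrow> replying reach N (\<lambda>b. if b = p then 0 else f b) p b1 r q w"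
  by (auto simp: replying_def valid_clear)

text \<open>The measure for fairness to the control process. Taking an announcement lowers it
  although the word still has to be written, as 3 exceeds the length of every word.\<close>

fun rank0 :: "local_state \<Rightarrow> local_state \<Rightarrow> nat" where
  "rank0 (Await q p) (Writer w p' r) = length w + (if p' = p then 0 else 3)"
| "rank0 _ _ = 0"

text \<open>The measure for fairness to the writer. It falls along a whole reply; back in
  \<open>Await\<close> it is 0, and only writer steps restore 5.\<close>

fun rank1 :: "local_state \<Rightarrow> local_state \<Rightarrow> nat" where
  "rank1 (Await q p) (Writer w p' r) = (if w = [] \<and> p' = p then 5 else 0)"
| "rank1 (Reset q w p) _ = 4"
| "rank1 (Announce q w p) _ = 3"
| "rank1 (Fence q w p) _ = 2"
| "rank1 (Check q w p) _ = 1"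
| "rank1 _ _ = 0"

text \<open>\<open>reach\<close> stands for the reachable configurations of a machine that never
  halts, which is what \<open>0 < q\<close> expresses.\<close>

locale gadget_safe = gadget +
  fixes reach
  assumes reach_bounds: "reach (q, u) \<Longrightarrow> 0 < q \<and> q < N"
    and reach_step: "reach (q, a # u) \<Longrightarrow> \<delta> q a = (w, q') \<Longrightarrow> reach (q', u @ w)"
begin

lemma update_writer:
  assumes "view c s t b0 b1 f y" "valid b1 f" "update_step P c c'"
  shows "(\<exists>v x d. b1 = v @ [(x, d)] \<and> view c' s t b0 v (\<lambda>b. if xv b = x then d else f b) y
      \<and> valid v (\<lambda>b. if xv b = x then d else f b)) \<or>
    (\<exists>v x d. b0 = v @ [(x, d)] \<and>
      view c' s t v b1 (\<lambda>b. if xv b = x then d else f b) (if x = 2 then d else y))"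
  using update_view[OF assms(1,3)]
proof (elim disjE exE conjE)
  fix v x d assume v: "b1 = v @ [(x, d)]"
    "view c' s t b0 v (\<lambda>b. if xv b = x then d else f b) (if x = 2 then d else y)"
  have "x \<noteq> 2" "valid v (\<lambda>b. if xv b = x then d else f b)"
    using valid_snoc[of v x d f] assms(2) v(1) by auto
  with v show ?thesis by auto
qed blast

lemma A_invariant_update:
  assumes "A_invariant reach N s t b0 b1 f y" "view c s t b0 b1 f y" "update_step P c c'"
  shows "\<exists>b0 b1 f y. view c' s t b0 b1 f y \<and> A_invariant reach N s t b0 b1 f y"
proof -
  have "valid b1 f" using assms(1) by cases (auto simp: replying_def)
  from update_writer[OF assms(2) this assms(3)] show ?thesis
  proof (elim disjE exE conjE)
    fix v x d
    let ?f = "\<lambda>b. if xv b = x then d else f b"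
    assume b1: "b1 = v @ [(x, d)]" and v': "view c' s t b0 v ?f y" and vl: "valid v ?f"
    from assms(1) have "A_invariant reach N s t b0 v ?f y"
    proof cases
      case (read p r u q w w')
      note c = content_update[OF read(5,6)[unfolded b1]]
      show ?thesis unfolding read(1-4) by (rule A_invariant.read[where reach = reach and N = N, OF vl c read(7-9)])
    next
      case (unread p r u q w)
      note c = content_update[OF unread(5,6)[unfolded b1]]
      show ?thesis unfolding unread(1-4) by (rule A_invariant.unread[where reach = reach and N = N, OF vl c unread(7,8)])
    next
      case (reset p r q w w')
      show ?thesis unfolding reset(1-4)
        by (rule A_invariant.reset[where reach = reach and N = N, OF replying_update(1)[OF reset(5)[unfolded b1]] reset(6)])
    next
      case (announce p r q w w')
      note m = replying_update[OF announce(4)[unfolded b1]]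
      show ?thesis unfolding announce(1-3)
        by (rule A_invariant.announce[where reach = reach and N = N, OF m(1) announce(5)]) (use announce(6) m(2) in argo)
    next
      case (fence p r q w w')
      note m = replying_update[OF fence(4)[unfolded b1]]
      show ?thesis unfolding fence(1-3)
        by (rule A_invariant.fence[where reach = reach and N = N, OF m(1) fence(5)]) (use fence(6) m(2) in argo)
    next
      case (fenced p r q w)
      note m = replying_update[OF fenced(4)[unfolded b1]]
      show ?thesis unfolding fenced(1-3)
        by (rule A_invariant.fenced[where reach = reach and N = N, OF m(1) m(2)[OF fenced(5)] fenced(6)])
    next
      case (sink w w' p r p')
      show ?thesis unfolding sink(1-4) by (rule A_invariant.sink[where reach = reach and N = N, OF vl sink(6,7)])
    qed
    with v' show ?thesis by blast
  next
    fix v x d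
    let ?f = "\<lambda>b. if xv b = x then d else f b" and ?y = "if x = 2 then d else y"
    assume b0: "b0 = v @ [(x, d)]" and v': "view c' s t v b1 ?f ?y"
    from assms(1) have "A_invariant reach N s t v b1 ?f ?y"
    proof cases
      case (announce p r q w w')
      then have e: "v = []" "?f = (\<lambda>b. if b = p then 0 else f b)" "?y = y" using b0 by auto
      show ?thesis unfolding e unfolding announce(1-3)
        by (rule A_invariant.announce[where reach = reach and N = N, OF replying_clear[OF announce(4)] announce(5)]) simp
    next
      case (fence p r q w w')
      then have "v = [(2, yv w p)] \<and> x = xv p \<and> d = 0 \<or> v = [] \<and> x = 2 \<and> d = yv w p \<and> clear f p"
        using b0 by (auto simp: append_eq_Cons_conv eq_commute[of "_ # _" "_ @ _"])
      then show ?thesis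
      proof (elim disjE conjE)
        assume "v = [(2, yv w p)]" "x = xv p" "d = 0"
        then have e: "v = [(2, yv w p)]" "?f = (\<lambda>b. if b = p then 0 else f b)" "?y = y" by auto
        show ?thesis unfolding e unfolding fence(1-3)
          by (rule A_invariant.fence[where reach = reach and N = N, OF replying_clear[OF fence(4)] fence(5)]) simp
      next
        assume "v = []" "x = 2" "d = yv w p" "clear f p"
        then have e: "v = []" "?f = f" "?y = yv w p" by auto
        show ?thesis unfolding e unfolding fence(1,2)
          by (rule A_invariant.fenced[where reach = reach and N = N, OF fence(4) \<open>clear f p\<close>]) simp
      qed
    qed (use b0 in auto)
    with v' show ?thesis by blast
  qed
qed

definition "states_of c = (from_nat (loc c 0) :: local_state, from_nat (loc c 1) :: local_state)"
  for c :: "(nat, nat, nat, nat) tso_conf"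

lemma states_of_view: "view c s t b0 b1 f y \<Longrightarrow> states_of c = (s, t)"
  by (simp add: states_of_def view_def)

text \<open>The rank \<open>rank0\<close> is nonzero iff the writer still has to take or to write an announced word. Moving the
  control process in this situation could overwrite an announcement.\<close>

definition "mover c = (if instr_enabled P 0 c \<and> case_prod rank0 (states_of c) = 0 then 0 else 1 :: nat)"

lemma mover_view:
  "view c s t b0 b1 f y \<Longrightarrow> mover c = (if instr_enabled P 0 c \<and> rank0 s t = 0 then 0 else 1)"
  by (simp add: mover_def states_of_view)

definition good_move where
  "good_move c s t c' \<longleftrightarrow> (\<exists>s' t' b0 b1 f y. view c' s' t' b0 b1 f y \<and> A_invariant reach N s' t' b0 b1 f y \<and>
     (if mover c = 0 then rank1 s' t' < rank1 s t
      else rank0 s' t' < rank0 s t \<or> \<not> instr_enabled P 0 c \<and> rank0 s' t' \<le> rank0 s t))"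

lemma good_moveI:
  assumes "view c' s' t' b0 b1 f y" "A_invariant reach N s' t' b0 b1 f y"
    and "if mover c = 0 then rank1 s' t' < rank1 s t
      else rank0 s' t' < rank0 s t \<or> \<not> instr_enabled P 0 c \<and> rank0 s' t' \<le> rank0 s t"
  shows "good_move c s t c'"
  using assms unfolding good_move_def by blast

lemma A_invariant_move:
  assumes "A_invariant reach N s t b0 b1 f y" "view c s t b0 b1 f y"
  shows "instr_enabled P (mover c) c \<and> (instr_step P (mover c) c c' \<longrightarrow> good_move c s t c')"
  using assms(1)
proof cases
  case (read p r u q w w')
  note v = assms(2)[unfolded read(1-4)]
  have q: "0 < q" "q < N" using reach_bounds read by auto
  show ?thesis
  proof (cases w)
    case (Cons a w1)
    then have m: "mover c = 1" using mover_view[OF v] by simp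
    note v = v[unfolded Cons]
    have "good_move c s t c'" if st: "instr_step P 1 c c'"
    proof -
      have v': "a # w1 \<in> words" "view c' (Await q p) (Writer w1 p (\<not> r)) [] ((xv r, a) # b1) f y"
        using writer_write_step[OF v st] read(4) by auto
      have "A_invariant reach N (Await q p) (Writer w1 p (\<not> r)) [] ((xv r, a) # b1) f y"
        unfolding read(4)
        by (rule A_invariant.read[of _ _ _ _ "u @ [a]"])
          (use read Cons words_Cons[OF v'(1)] in \<open>auto intro: valid_Cons content_write\<close>)
      from good_moveI[OF v'(2) this] show ?thesis using m read(1,2) Cons by simp
    qed
    then show ?thesis using m writer_write_enabled[OF v] read Cons by simp
  next
    case Nil
    note v = v[unfolded Nil]
    show ?thesis
    proof (cases "f p = 0")
      case True
      have d: "\<not> instr_enabled P 0 c" using await_disabled[OF v True] .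
      have "good_move c s t c'" if st: "instr_step P 1 c c'"
      proof -
        have "c' = c" using writer_read_step[OF v _ st] read by simp
        from good_moveI[OF assms(2,1)] show ?thesis using d mover_view[OF v] \<open>c' = c\<close> by simp
      qed
      then show ?thesis using d mover_view[OF v] writer_read_enabled[OF v] read by simp
    next
      case False
      then have f: "f p \<in> {1, 2, 3}" using valid_range[of b1 f p] read by auto
      have e: "instr_enabled P 0 c" using await_enabled[OF v q f] .
      then have m: "mover c = 0" using mover_view[OF v] by simp
      have "good_move c s t c'" if st: "instr_step P 0 c c'"
      proof -
        obtain w1 q1 where w1: "\<delta> q (f p) = (w1, q1)" "w1 \<in> words" "q1 < N"
          "view c' (Reset q1 w1 p) (Writer [] p r) [] b1 f (yv w' (\<not> p))"
          using await_step[OF v st] by blast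
        \<comment> \<open>If the other variable is unset, then \<open>f p \<noteq> 0\<close> leaves
          only the last case of \<open>content\<close>: the symbol read is the front of the queue,
          and \<open>reach_step\<close> applies.\<close>
        have "replying reach N f p b1 r q1 w1"
          unfolding replying_def using read Nil False w1(2,3) reach_step[OF _ w1(1)]
          by (auto simp: content_def)
        from good_moveI[OF w1(4) A_invariant.reset[where reach = reach and N = N, OF this read(9)]] show ?thesis
          using read(1,2) m Nil by simp
      qed
      then show ?thesis using e m by simp
    qed
  qed
next
  case (unread p r u q w)
  note v = assms(2)[unfolded unread(1-4)]
  have m: "mover c = 1" using mover_view[OF v] by simp
  have "good_move c s t c'" if st: "instr_step P 1 c c'"
  proof -
    have v': "view c' (Await q p) (Writer w p r) [] b1 f (yv w (\<not> p))"
      using writer_read_step[OF v _ st] unread by simp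
    have "A_invariant reach N (Await q p) (Writer w p r) [] b1 f (yv w (\<not> p))"
      using A_invariant.read[where reach = reach and N = N, OF unread(5-8,8)] .
    from good_moveI[OF v' this] show ?thesis
      using m unread(1,2) length_words[OF unread(8)] by simp
  qed
  then show ?thesis using m writer_read_enabled[OF v] unread by simp
next
  case (reset p r q w w')
  note v = assms(2)[unfolded reset(1-4)]
  have e: "instr_enabled P 0 c" by (rule reset_enabled[OF v]) (use reset in \<open>auto simp: replying_def\<close>)
  then have m: "mover c = 0" using mover_view[OF v] by simp
  have "good_move c s t c'" if st: "instr_step P 0 c c'"
    by (rule good_moveI[OF reset_step[OF v st]
          A_invariant.announce[where reach = reach and N = N, OF reset(5-6)]])
      (use m reset(1,2) in simp_all)
  then show ?thesis using e m by simp
next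
  case (announce p r q w w')
  note v = assms(2)[unfolded announce(1-3)]
  have e: "instr_enabled P 0 c" by (rule announce_enabled[OF v]) (use announce in \<open>auto simp: replying_def\<close>)
  then have m: "mover c = 0" using mover_view[OF v] by simp
  have "good_move c s t c'" if st: "instr_step P 0 c c'"
    by (rule good_moveI[OF announce_step[OF v st] A_invariant.fence[where reach = reach and N = N, OF announce(4-5)]])
      (use m announce(1,2,6) in auto)
  then show ?thesis using e m by simp
next
  case (fence p r q w w')
  note v = assms(2)[unfolded fence(1-3)]
  \<comment> \<open>The fence is blocked until the update player has emptied the buffer, so spinning
    in the meantime is fair.\<close>
  have d: "\<not> instr_enabled P 0 c"
    using fence_step[OF v] fence unfolding instr_enabled_def by blast
  then have m: "mover c = 1" using mover_view[OF v] by simp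
  have vl: "valid b1 f" using fence by (simp add: replying_def)
  have "good_move c s t c'" if st: "instr_step P 1 c c'"
  proof -
    have "c' = c" using writer_read_step[OF v vl st] by simp
    with good_moveI[OF assms(2,1)] show ?thesis using d m by simp
  qed
  then show ?thesis using m writer_read_enabled[OF v vl] fence by simp
next
  case (fenced p r q w)
  note v = assms(2)[unfolded fenced(1-3)]
  have b: "q < N" "w \<in> words" "valid b1 f" using fenced by (auto simp: replying_def)
  from fenced(6) show ?thesis
  proof
    assume s: "s = Fence q w p"
    note v = v[unfolded s]
    have e: "instr_enabled P 0 c" by (rule fence_enabled[OF v b(1,2)])
    then have m: "mover c = 0" using mover_view[OF v] by simp
    have "good_move c s t c'" if st: "instr_step P 0 c c'"
      by (rule good_moveI[OF conjunct2[OF fence_step[OF v st]] A_invariant.fenced[where reach = reach and N = N, OF fenced(4,5)]])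
        (use m s in simp_all)
    then show ?thesis using e m by simp
  next
    assume s: "s = Check q w p"
    note v = v[unfolded s]
    have e: "instr_enabled P 0 c" by (rule check_enabled[OF v b(1,2) valid_range[OF b(3)]])
    then have m: "mover c = 0" using mover_view[OF v] by simp
    have "good_move c s t c'" if st: "instr_step P 0 c c'"
      using check_step[OF v st]
    proof (elim disjE conjE)
      assume f: "f (\<not> p) = 0" and v': "view c' (Await q (\<not> p)) (Writer [] p r) [] b1 f (yv w p)"
      obtain u where u: "b1 = rev (msgs (\<not> p) u)" "r = par (\<not> p) u" "reach (q, u @ w)"
        using fenced(4) f by (auto simp: replying_def)
      have ct: "content f (\<not> p) b1 r u" using u f fenced(5) by (simp add: content_def)
      have "A_invariant reach N (Await q (\<not> p)) (Writer [] p r) [] b1 f (yv w p)"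
        using A_invariant.unread[where reach = reach and N = N, OF b(3) ct u(3) b(2)] by simp
      from good_moveI[OF v' this] show ?thesis using m s fenced(1) by simp
    next
      assume "view c' Sink (Writer [] p r) [] b1 f (yv w p)"
      from good_moveI[OF this A_invariant.sink[where reach = reach and N = N, OF b(3) Nil_words b(2)]]
      show ?thesis using m s by simp
    qed
    then show ?thesis using e m by simp
  qed
next
  case (sink w w' p r p')
  note v = assms(2)[unfolded sink(1-4)]
  have d: "\<not> instr_enabled P 0 c" by (rule sink_disabled[OF v])
  then have m: "mover c = 1" using mover_view[OF v] by simp
  show ?thesis
  proof (cases w)
    case (Cons a w1)
    note v = v[unfolded Cons]
    have "good_move c s t c'" if st: "instr_step P 1 c c'"
    proof -
      have v': "a # w1 \<in> words" "view c' Sink (Writer w1 p (\<not> r)) [] ((xv r, a) # b1) f (yv w' p')"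
        using writer_write_step[OF v st] by auto
      have "A_invariant reach N Sink (Writer w1 p (\<not> r)) [] ((xv r, a) # b1) f (yv w' p')"
        by (rule A_invariant.sink) (use sink words_Cons[OF v'(1)] in \<open>auto intro: valid_Cons\<close>)
      from good_moveI[OF v'(2) this] show ?thesis using m d sink(1) by simp
    qed
    then show ?thesis using m writer_write_enabled[OF v] sink Cons by simp
  next
    case Nil
    note v = v[unfolded Nil]
    have "good_move c s t c'" if st: "instr_step P 1 c c'"
      using writer_read_step[OF v sink(5) st]
    proof (elim disjE conjE)
      assume "view c' Sink (Writer w' (\<not> p) r) [] b1 f (yv w' p')"
      from good_moveI[OF this A_invariant.sink[where reach = reach and N = N, OF sink(5,7,7)]]
      show ?thesis using m d sink(1) by simp
    next
      assume "c' = c"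
      with good_moveI[OF assms(2,1)] show ?thesis using m d by simp
    qed
    then show ?thesis using m writer_read_enabled[OF v] sink by simp
  qed
qed

end


lemma targets_Await [simp]: "to_nat (Await q p) \<in> targets \<longleftrightarrow> q = 0"
  by (cases p) (auto simp: targets_def)

context gadget_safe
begin

section \<open>The winning strategy of the process player\<close>

lemma A_invariant_updates:
  assumes "(update_step P)\<^sup>*\<^sup>* c c'" "A_invariant reach N s t b0 b1 f y" "view c s t b0 b1 f y"
  shows "\<exists>b0 b1 f y. view c' s t b0 b1 f y \<and> A_invariant reach N s t b0 b1 f y"
  using assms(1)
proof (induction rule: rtranclp_induct)
  case base
  then show ?case using assms(2,3) by blast
next
  case (step d e)
  then show ?case using A_invariant_update by blast
qed

definition "invariant c \<longleftrightarrow> (\<exists>s t b0 b1 f y. view c s t b0 b1 f y \<and> A_invariant reach N s t b0 b1 f y)"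

definition "chosen c = (SOME c'. instr_step P (mover c) c c')"

lemma chosen_step: "invariant c \<Longrightarrow> instr_step P (mover c) c (chosen c)"
  unfolding chosen_def invariant_def using A_invariant_move by (metis instr_enabled_def someI_ex)

lemma chosen_good:
  assumes "view c s t b0 b1 f y" "A_invariant reach N s t b0 b1 f y"
  shows "good_move c s t (chosen c)"
  using assms A_invariant_move chosen_step unfolding invariant_def by blast

lemma safe_locs:
  assumes "view c s t b0 b1 f y" "A_invariant reach N s t b0 b1 f y" "i \<in> procs P"
  shows "loc c i \<notin> targets"
  using assms(2)
proof cases
  case (read p r u q w w')
  then show ?thesis using assms(1,3) reach_bounds by (fastforce simp: procs view_def targets_def)
next
  case (unread p r u q w)
  then show ?thesis using assms(1,3) reach_bounds by (fastforce simp: procs view_def targets_def)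
qed (use assms(1,3) in \<open>auto simp: procs view_def targets_def\<close>)

lemma process_player_wins:
  assumes "view c s t b0 b1 f y" "A_invariant reach N s t b0 b1 f y" "c \<in> tso_confs P"
  shows "A_wins_from (tso_game P) (W_S P targets \<inter> W_P P) (ConfA c)"
proof (rule A_wins_fromI[where Inv = invariant and pl = mover and mv = chosen
      and \<mu> = "\<lambda>i c. if i = 0 then case_prod rank0 (states_of c) else case_prod rank1 (states_of c)"])
  show "wf_program P" by (rule wf)
  show "invariant c" using assms unfolding invariant_def by blast
  show "c \<in> tso_confs P" by (rule assms)
  fix c assume "invariant c"
  then obtain s t b0 b1 f y where v: "view c s t b0 b1 f y" and inv: "A_invariant reach N s t b0 b1 f y"
    by (auto simp: invariant_def)
  obtain s' t' b0' b1' f' y' where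
    v': "view (chosen c) s' t' b0' b1' f' y'" and inv': "A_invariant reach N s' t' b0' b1' f' y'" and
    rk: "if mover c = 0 then rank1 s' t' < rank1 s t
      else rank0 s' t' < rank0 s t \<or> \<not> instr_enabled P 0 c \<and> rank0 s' t' \<le> rank0 s t"
    using chosen_good[OF v inv] unfolding good_move_def by blast
  show "mover c \<in> procs P \<and> instr_step P (mover c) c (chosen c)"
    using chosen_step[OF \<open>invariant c\<close>] by (simp add: procs mover_def)
  show "loc c i \<notin> targets" if "i \<in> procs P" for i using safe_locs[OF v inv that] .
  fix c' assume u: "(update_step P)\<^sup>*\<^sup>* (chosen c) c'"
  obtain b0 b1 f y where v'': "view c' s' t' b0 b1 f y" and inv'': "A_invariant reach N s' t' b0 b1 f y"
    using A_invariant_updates[OF u inv' v'] by blast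
  then show "invariant c'" unfolding invariant_def by blast
  fix i assume "i \<in> procs P" "i \<noteq> mover c"
  then show "(if i = 0 then case_prod rank0 (states_of c') else case_prod rank1 (states_of c'))
      < (if i = 0 then case_prod rank0 (states_of c) else case_prod rank1 (states_of c)) \<or>
    \<not> instr_enabled P i c \<and> (if i = 0 then case_prod rank0 (states_of c') else case_prod rank1 (states_of c'))
      \<le> (if i = 0 then case_prod rank0 (states_of c) else case_prod rank1 (states_of c))"
    using rk states_of_view[OF v] states_of_view[OF v'']
    by (auto simp: procs mover_def split: if_splits)
qed

end

section \<open>The update player wins if the machine halts\<close>

inductive halts_in :: "(nat \<Rightarrow> nat \<Rightarrow> nat list \<times> nat) \<Rightarrow> nat \<Rightarrow> nat \<times> nat list \<Rightarrow> bool" for \<delta> where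
  "halts_in \<delta> 0 (0, u)"
| "qstep \<delta> c d \<Longrightarrow> halts_in \<delta> k d \<Longrightarrow> halts_in \<delta> (Suc k) c"

lemma qsteps_halts_in: "qsteps \<delta> c (0, u) \<Longrightarrow> \<exists>k. halts_in \<delta> k c"
  by (induction rule: converse_rtranclp_induct) (blast intro: halts_in.intros)+

lemma halts_in_step:
  assumes "halts_in \<delta> k (q, u)" "0 < q"
  shows "\<exists>k' a v. k = Suc k' \<and> u = a # v \<and> halts_in \<delta> k' (snd (\<delta> q a), v @ fst (\<delta> q a))"
  using assms by (auto elim!: halts_in.cases[of \<delta> k] qstep.cases)

text \<open>The announcement has reached the memory. The number \<open>m\<close> counts the remaining steps of the control process.\<close>

definition answered where
  "answered q w p s m \<longleftrightarrow> s = Fence q w p \<and> m = 2 \<or> s = Check q w p \<and> m = 1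
     \<or> s = Await q (\<not> p) \<and> m = (0 :: nat) \<and> 0 < q"

text \<open>The index is the rank. Reading the symbol leads from \<open>10 * Suc k\<close> to
  \<open>10 * k + 9\<close>, the reset to \<open>10 * k + 8\<close>, the announcement to
  \<open>10 * k + 5\<close>. An unread announcement weighs 3, more than any word is long, and
  appending counts down to the next delivery at \<open>10 * k\<close>. The update player flushes the
  control buffer at once, which keeps it empty. The case \<open>m = 0\<close> with nothing left to
  write is excluded, because there the next symbol is delivered immediately.\<close>

inductive B_invariant for \<delta> :: "nat \<Rightarrow> nat \<Rightarrow> nat list \<times> nat" and N :: nat where
  await: "\<lbrakk>0 < q; q < N; f (\<not> p) = 0; set (f p # v) \<subseteq> {1, 2, 3}; halts_in \<delta> k (q, f p # v); w \<in> words\<rbrakk> \<Longrightarrow>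
    B_invariant \<delta> N (10 * k) (Await q p) (Writer [] p (par (\<not> p) v)) [] (rev (msgs (\<not> p) v)) f (yv w (\<not> p))"
| reset: "\<lbrakk>q < N; w \<in> words; f (\<not> p) = 0; set (f p # v) \<subseteq> {1, 2, 3}; halts_in \<delta> k (q, v @ w); w' \<in> words\<rbrakk> \<Longrightarrow>
    B_invariant \<delta> N (10 * k + 9) (Reset q w p) (Writer [] p (par (\<not> p) v)) [] (rev (msgs (\<not> p) v)) f (yv w' (\<not> p))"
| announce: "\<lbrakk>q < N; w \<in> words; set v \<subseteq> {1, 2, 3}; halts_in \<delta> k (q, v @ w); w' \<in> words\<rbrakk> \<Longrightarrow>
    B_invariant \<delta> N (10 * k + 8) (Announce q w p) (Writer [] p (par (\<not> p) v)) [] (rev (msgs (\<not> p) v)) (\<lambda>_. 0) (yv w' (\<not> p))"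
| unread: "\<lbrakk>q < N; w \<in> words; set v \<subseteq> {1, 2, 3}; halts_in \<delta> k (q, v @ w); answered q w p s m\<rbrakk> \<Longrightarrow>
    B_invariant \<delta> N (10 * k + m + 3) s (Writer [] p (par (\<not> p) v)) [] (rev (msgs (\<not> p) v)) (\<lambda>_. 0) (yv w p)"
| read: "\<lbrakk>q < N; w \<in> words; w1 \<in> words; set v \<subseteq> {1, 2, 3}; halts_in \<delta> k (q, v @ w1); answered q w p s m;
      m = 0 \<longrightarrow> w1 \<noteq> []\<rbrakk> \<Longrightarrow>
    B_invariant \<delta> N (10 * k + m + length w1) s (Writer w1 (\<not> p) (par (\<not> p) v)) [] (rev (msgs (\<not> p) v)) (\<lambda>_. 0) (yv w p)"

lemma valid_msgs:
  assumes "set u \<subseteq> {1, 2, 3}" "\<And>b. f b \<in> {0, 1, 2, 3}"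
  shows "valid (rev (msgs b u)) f"
proof -
  have "set (msgs b u) \<subseteq> range xv \<times> {1, 2, 3}" using assms(1) by (induction u arbitrary: b) auto
  then show ?thesis using assms(2) by (auto simp: valid_def)
qed

context gadget
begin

definition progress where
  "progress n c' \<longleftrightarrow> (\<exists>c'' n' s t b0 b1 f y. (update_step P)\<^sup>*\<^sup>* c' c'' \<and>
     view c'' s t b0 b1 f y \<and> B_invariant \<delta> N n' s t b0 b1 f y \<and> n' < n)"

lemma progressI: "view c s t b0 b1 f y \<Longrightarrow> B_invariant \<delta> N n' s t b0 b1 f y \<Longrightarrow> n' < n \<Longrightarrow> progress n c"
  unfolding progress_def by blast

lemma progress_update:
  "update_step P c d \<Longrightarrow> view d s t b0 b1 f y \<Longrightarrow> B_invariant \<delta> N n' s t b0 b1 f y \<Longrightarrow> n' < n \<Longrightarrow> progress n c"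
  unfolding progress_def by blast

text \<open>A halting run from a state other than 0 has a step left, so the queue is nonempty and a
  symbol can be delivered.\<close>

lemma deliver:
  assumes v: "view c (Await q p) (Writer [] p (par p u)) [] (rev (msgs p u)) (\<lambda>_. 0) (yv w (\<not> p))"
    and "0 < q" "q < N" "set u \<subseteq> {1, 2, 3}" "halts_in \<delta> k (q, u)" "w \<in> words" "10 * k < n"
  shows "progress n c"
proof -
  obtain a v where u: "u = a # v" using halts_in_step assms(2,5) by blast
  let ?f = "\<lambda>b. if xv b = xv p then a else 0"
  obtain d where d: "update_step P c d"
    "view d (Await q p) (Writer [] p (par (\<not> p) v)) [] (rev (msgs (\<not> p) v)) ?f (yv w (\<not> p))"
    using update1[OF v[unfolded u msgs.simps rev.simps]] u by auto
  have "B_invariant \<delta> N (10 * k) (Await q p) (Writer [] p (par (\<not> p) v)) [] (rev (msgs (\<not> p) v)) ?f (yv w (\<not> p))"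
    by (rule B_invariant.await) (use assms u in auto)
  from progress_update[OF d this assms(7)] show ?thesis .
qed

definition idles where
  "idles c c' \<longleftrightarrow> c' = c \<and> instr_enabled P 0 c \<and> \<not> instr_step P 0 c c'"

lemma idlesI: "view c s t b0 b1 f y \<Longrightarrow> c' = c \<Longrightarrow> instr_enabled P 0 c \<Longrightarrow> idles c c'"
  unfolding idles_def using control_no_self_step by blast

lemma B_invariant_move:
  assumes "B_invariant \<delta> N n s t b0 b1 f y" "view c s t b0 b1 f y" "i = 0 \<or> i = 1" "instr_step P i c c'"
  shows "loc c' 0 \<in> targets \<or> progress n c' \<or> idles c c'"
  using assms(1)
proof cases
  case (await q p v k w)
  note vw = assms(2)[unfolded await(2-6)]
  have e: "instr_enabled P 0 c" by (rule await_enabled[OF vw]) (use await in auto)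
  show ?thesis
  proof (cases "i = 0")
    case True
    then have st: "instr_step P 0 c c'" using assms(4) by simp
    obtain w1 q1 where w1: "\<delta> q (f p) = (w1, q1)" "w1 \<in> words" "q1 < N"
      "view c' (Reset q1 w1 p) (Writer [] p (par (\<not> p) v)) [] (rev (msgs (\<not> p) v)) f (yv w (\<not> p))"
      using await_step[OF vw st] by blast
    obtain k' where k': "k = Suc k'" "halts_in \<delta> k' (q1, v @ w1)"
      using halts_in_step[OF await(11,7)] w1(1) by auto
    have "progress n c'"
      by (rule progressI[OF w1(4) B_invariant.reset[OF w1(3,2) _ _ k'(2)]]) (use await k'(1) in auto)
    then show ?thesis by simp
  next
    case False
    then have st: "instr_step P 1 c c'" using assms(3,4) by auto
    have "valid (rev (msgs (\<not> p) v)) f"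
    proof (rule valid_msgs)
      show "f b \<in> {0, 1, 2, 3}" for b using await(9,10) by (cases "b = p") auto
    qed (use await in auto)
    from idlesI[OF vw _ e] writer_read_step[OF vw this st] show ?thesis by auto
  qed
next
  case (reset q w p v k w')
  note vw = assms(2)[unfolded reset(2-6)]
  have e: "instr_enabled P 0 c" by (rule reset_enabled[OF vw]) (use reset in auto)
  show ?thesis
  proof (cases "i = 0")
    case True
    then have st: "instr_step P 0 c c'" using assms(4) by simp
    obtain d where d: "update_step P c' d" "view d (Announce q w p) (Writer [] p (par (\<not> p) v)) []
      (rev (msgs (\<not> p) v)) (\<lambda>b. if xv b = xv p then 0 else f b) (yv w' (\<not> p))"
      using update0[where w = "[]", unfolded append_Nil, OF reset_step[OF vw st]] by auto
    have "(\<lambda>b. if xv b = xv p then 0 else f b) = (\<lambda>_. 0)"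
    proof
      show "(if xv b = xv p then 0 else f b) = 0" for b using reset(9) by (cases "b = p") auto
    qed
    note d = d[unfolded this]
    have "progress n c'"
      by (rule progress_update[OF d B_invariant.announce]) (use reset in auto)
    then show ?thesis by simp
  next
    case False
    then have st: "instr_step P 1 c c'" using assms(3,4) by auto
    have "valid (rev (msgs (\<not> p) v)) f"
    proof (rule valid_msgs)
      show "f b \<in> {0, 1, 2, 3}" for b using reset(9,10) by (cases "b = p") auto
    qed (use reset in auto)
    from idlesI[OF vw _ e] writer_read_step[OF vw this st] show ?thesis by auto
  qed
next
  case (announce q w v k w' p)
  note vw = assms(2)[unfolded announce(2-7)]
  have e: "instr_enabled P 0 c" by (rule announce_enabled[OF vw]) (use announce in auto)
  show ?thesis
  proof (cases "i = 0")
    case True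
    then have st: "instr_step P 0 c c'" using assms(4) by simp
    obtain d where d: "update_step P c' d" "view d (Fence q w p) (Writer [] p (par (\<not> p) v)) []
      (rev (msgs (\<not> p) v)) (\<lambda>_. 0) (yv w p)"
      using update0[where w = "[]", unfolded append_Nil, OF announce_step[OF vw st]] by auto
    have "progress n c'"
      by (rule progress_update[OF d B_invariant.unread[where m = 2]]) (use announce in \<open>auto simp: answered_def\<close>)
    then show ?thesis by simp
  next
    case False
    then have st: "instr_step P 1 c c'" using assms(3,4) by auto
    have "valid (rev (msgs (\<not> p) v)) (\<lambda>_. 0)"
      by (rule valid_msgs) (use announce in auto)
    from idlesI[OF vw _ e] writer_read_step[OF vw this st] show ?thesis by auto
  qed
next
  case (unread q w v k p m)
  note vw = assms(2)[unfolded unread(2-6)]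
  show ?thesis
  proof (cases "i = 0")
    case True
    then have st: "instr_step P 0 c c'" using assms(4) by simp
    from unread(11) consider "s = Fence q w p" "m = 2" | "s = Check q w p" "m = 1" | "s = Await q (\<not> p)"
      by (auto simp: answered_def)
    then show ?thesis
    proof cases
      case 1
      have "progress n c'"
        by (rule progressI[OF conjunct2[OF fence_step[OF vw[unfolded 1] st]] B_invariant.unread[where m = 1]])
          (use unread 1 in \<open>auto simp: answered_def\<close>)
      then show ?thesis by simp
    next
      case 2
      have v': "view c' (Await q (\<not> p)) (Writer [] p (par (\<not> p) v)) [] (rev (msgs (\<not> p) v)) (\<lambda>_. 0) (yv w p)"
        using check_step[OF vw[unfolded 2] st] by simp
      \<comment> \<open>If the simulated step ends in machine state 0, the control process has just
        entered a target.\<close>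
      show ?thesis
      proof (cases "q = 0")
        case True
        then show ?thesis using v' by (simp add: view_def)
      next
        case False
        have "progress n c'"
          by (rule progressI[OF v' B_invariant.unread[where m = 0]])
            (use unread 2 False in \<open>auto simp: answered_def\<close>)
        then show ?thesis by simp
      qed
    next
      case 3
      then show ?thesis using await_step[OF vw[unfolded 3] st] by simp
    qed
  next
    case False
    then have st: "instr_step P 1 c c'" using assms(3,4) by auto
    have "valid (rev (msgs (\<not> p) v)) (\<lambda>_. 0)"
      by (rule valid_msgs) (use unread in auto)
    then have v': "view c' s (Writer w (\<not> p) (par (\<not> p) v)) [] (rev (msgs (\<not> p) v)) (\<lambda>_. 0) (yv w p)"
      using writer_read_step[OF vw _ st] by simp
    show ?thesis
    proof (cases "m = 0 \<and> w = []")
      case True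
      then have "s = Await q (\<not> p)" "0 < q" using unread(11) by (auto simp: answered_def)
      with True v' have "progress n c'"
        by (intro deliver[of c' q "\<not> p" v w k]) (use unread in auto)
      then show ?thesis by simp
    next
      case False
      have "progress n c'"
        by (rule progressI[OF v' B_invariant.read[where m = m]])
          (use unread False length_words[OF unread(8)] in auto)
      then show ?thesis by simp
    qed
  qed
next
  case (read q w w1 v k p m)
  note vw = assms(2)[unfolded read(2-6)]
  show ?thesis
  proof (cases "i = 0")
    case True
    then have st: "instr_step P 0 c c'" using assms(4) by simp
    from read(12) consider "s = Fence q w p" "m = 2" | "s = Check q w p" "m = 1" | "s = Await q (\<not> p)"
      by (auto simp: answered_def)
    then show ?thesis
    proof cases
      case 1
      have "progress n c'"
        by (rule progressI[OF conjunct2[OF fence_step[OF vw[unfolded 1] st]] B_invariant.read[where m = 1]])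
          (use read 1 in \<open>auto simp: answered_def\<close>)
      then show ?thesis by simp
    next
      case 2
      have v': "view c' (Await q (\<not> p)) (Writer w1 (\<not> p) (par (\<not> p) v)) [] (rev (msgs (\<not> p) v)) (\<lambda>_. 0) (yv w p)"
        using check_step[OF vw[unfolded 2] st] by simp
      show ?thesis
      proof (cases "q = 0")
        case True
        then show ?thesis using v' by (simp add: view_def)
      next
        case q: False
        show ?thesis
        proof (cases "w1 = []")
          case True
          with v' q have "progress n c'"
            by (intro deliver[of c' q "\<not> p" v w k]) (use read 2 in auto)
          then show ?thesis by simp
        next
          case False
          have "progress n c'"
            by (rule progressI[OF v' B_invariant.read[where m = 0]])
              (use read 2 False q in \<open>auto simp: answered_def\<close>)
          then show ?thesis by simp
        qed
      qed
    next
      case 3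
      then show ?thesis using await_step[OF vw[unfolded 3] st] by simp
    qed
  next
    case False
    then have st: "instr_step P 1 c c'" using assms(3,4) by auto
    show ?thesis
    proof (cases w1)
      case Nil
      note vw = vw[unfolded Nil]
      have "valid (rev (msgs (\<not> p) v)) (\<lambda>_. 0)"
        by (rule valid_msgs) (use read in auto)
      then have c: "c' = c" using writer_read_step[OF vw _ st] by simp
      \<comment> \<open>The word is finished but the control process is not yet waiting, so the spin
        merely postpones an enabled control step.\<close>
      have "m \<noteq> 0" using read(13) Nil by simp
      then consider "s = Fence q w p" | "s = Check q w p" using read(12) by (auto simp: answered_def)
      then have "instr_enabled P 0 c"
      proof cases
        case 1
        then show ?thesis using fence_enabled[of c q w p] vw read by simp
      next
        case 2
        then show ?thesis using check_enabled[of c q w p] vw read by simp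
      qed
      from idlesI[OF vw c this] show ?thesis by simp
    next
      case (Cons a w2)
      note vw = vw[unfolded Cons]
      have a: "a \<in> {1, 2, 3}" "w2 \<in> words" using words_Cons read(9) Cons by blast+
      have v': "view c' s (Writer w2 (\<not> p) (par (\<not> p) (v @ [a]))) [] (rev (msgs (\<not> p) (v @ [a])))
        (\<lambda>_. 0) (yv w p)"
        using writer_write_step[OF vw st] by simp
      show ?thesis
      proof (cases "m = 0 \<and> w2 = []")
        case True
        then have "s = Await q (\<not> p)" "0 < q" using read(12) by (auto simp: answered_def)
        with True v' have "progress n c'"
          by (intro deliver[of c' q "\<not> p" "v @ [a]" w k]) (use read Cons a in auto)
        then show ?thesis by simp
      next
        case False
        have "progress n c'"
          by (rule progressI[OF v' B_invariant.read[where m = m]]) (use read Cons False a in auto)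
        then show ?thesis by simp
      qed
    qed
  qed
qed

lemma update_player_wins:
  assumes "B_invariant \<delta> N n s t b0 b1 f y" "view c s t b0 b1 f y" "c \<in> tso_confs P"
  shows "\<not> A_wins_from (tso_game P) (W_S P targets \<inter> W_P P) (ConfA c)"
proof -
  \<comment> \<open>The criterion asks for a rank of configurations; the least index of the
    invariant provides one.\<close>
  define good where "good n c \<longleftrightarrow> (\<exists>s t b0 b1 f y. B_invariant \<delta> N n s t b0 b1 f y \<and> view c s t b0 b1 f y)" for n c
  show ?thesis
  proof (rule not_A_wins_fromI[where Good = "\<lambda>c. \<exists>n. good n c" and \<rho> = "\<lambda>c. LEAST n. good n c" and e = 0])
    show "wf_program P" "c \<in> tso_confs P" "0 \<in> procs P" by (simp_all add: wf assms procs)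
    show "\<exists>n. good n c" using assms unfolding good_def by blast
    fix c c' i assume "\<exists>n. good n c" "i \<in> procs P" "instr_step P i c c'"
    then have "good (LEAST n. good n c) c" and i: "i = 0 \<or> i = 1" "instr_step P i c c'"
      by (auto intro: LeastI_ex simp: procs)
    then obtain s t b0 b1 f y where "B_invariant \<delta> N (LEAST n. good n c) s t b0 b1 f y" "view c s t b0 b1 f y"
      by (auto simp: good_def)
    from B_invariant_move[OF this i] show "(\<exists>j\<in>procs P. loc c' j \<in> targets) \<or>
       (\<exists>c''. (update_step P)\<^sup>*\<^sup>* c' c'' \<and> (\<exists>n. good n c'') \<and>
          ((LEAST n. good n c'') < (LEAST n. good n c) \<or>
            c'' = c \<and> instr_enabled P 0 c \<and> \<not> instr_step P 0 c c'))"
    proof (elim disjE)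
      assume "progress (LEAST n. good n c) c'"
      then obtain c'' n' where "(update_step P)\<^sup>*\<^sup>* c' c''" "good n' c''" "n' < (LEAST n. good n c)"
        unfolding progress_def good_def by blast
      then show ?thesis using Least_le[of "\<lambda>n. good n c''" n'] by (meson le_less_trans)
    next
      assume "idles c c'"
      then show ?thesis using \<open>\<exists>n. good n c\<close> by (auto simp: idles_def)
    qed (auto simp: procs)
  qed
qed

end


section \<open>Undecidability\<close>

definition control_states :: "nat \<Rightarrow> local_state set" where
  "control_states N = case_prod Await ` ({..<N} \<times> UNIV)
     \<union> (\<lambda>(q, w, p). Reset q w p) ` ({..<N} \<times> words \<times> UNIV)
     \<union> (\<lambda>(q, w, p). Announce q w p) ` ({..<N} \<times> words \<times> UNIV)
     \<union> (\<lambda>(q, w, p). Fence q w p) ` ({..<N} \<times> words \<times> UNIV)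
     \<union> (\<lambda>(q, w, p). Check q w p) ` ({..<N} \<times> words \<times> UNIV) \<union> {Sink}"

definition writer_states :: "local_state set" where
  "writer_states = (\<lambda>(w, p, r). Writer w p r) ` (words \<times> UNIV)"

lemma control_states_iff [simp]:
  "Await q p \<in> control_states N \<longleftrightarrow> q < N"
  "Reset q w p \<in> control_states N \<longleftrightarrow> q < N \<and> w \<in> words"
  "Announce q w p \<in> control_states N \<longleftrightarrow> q < N \<and> w \<in> words"
  "Fence q w p \<in> control_states N \<longleftrightarrow> q < N \<and> w \<in> words"
  "Check q w p \<in> control_states N \<longleftrightarrow> q < N \<and> w \<in> words"
  "Sink \<in> control_states N"
  by (auto simp: control_states_def image_iff)

lemma writer_states_iff [simp]: "Writer w p r \<in> writer_states \<longleftrightarrow> w \<in> words"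
  by (auto simp: writer_states_def image_iff)

lemma finite_states: "finite (control_states N)" "finite writer_states"
  by (simp_all add: control_states_def writer_states_def finite_words)

text \<open>One data domain holds the symbols and the codes of all announcements. It does not depend
  on the machine and enters \<open>instance_code\<close> as a constant.\<close>

definition num_values :: nat where
  "num_values = Suc (Max (insert 3 (case_prod yv ` (words \<times> UNIV))))"

lemma yv_less: "w \<in> words \<Longrightarrow> yv w b < num_values"
  unfolding num_values_def less_Suc_eq_le by (rule Max_ge) (auto simp: finite_words)

lemma symbol_less: "a \<le> 3 \<Longrightarrow> a < num_values"
proof -
  have "3 \<le> Max (insert 3 (case_prod yv ` (words \<times> UNIV)))"
    by (rule Max_ge) (auto simp: finite_words)
  then show "a \<le> 3 \<Longrightarrow> a < num_values" by (simp add: num_values_def)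
qed

text \<open>Arbitrary for infinite \<open>S\<close>.\<close>

definition listing :: "'a set \<Rightarrow> 'a list" where
  "listing S = (SOME xs. set xs = S)"

lemma set_listing: "finite S \<Longrightarrow> set (listing S) = S"
  unfolding listing_def using finite_list by (rule someI_ex)

text \<open>The order of the lists is left to choice. This is harmless because the machine never
  computes them; their code is its input.\<close>

definition procs_of where
  "procs_of \<delta> N =
     [(listing (to_nat ` control_states N), listing {(to_nat s, a, to_nat t) | s a t. controls \<delta> N s a t}),
      (listing (to_nat ` writer_states), listing {(to_nat s, a, to_nat t) | s a t. writes s a t})]"

text \<open>The machine starts in state 1 with the queue \<open>blocks [e] @ [3]\<close>. The
  process player moves first, so the leading 2 is already delivered to variable 0 and the buffer
  continues on variable 1. Variable 2 holds an old announcement on which the writer can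
  spin.\<close>

definition tso_instance :: "(nat list \<times> (nat \<times> (nat, nat) instr \<times> nat) list) list \<Rightarrow> nat \<Rightarrow> tso_input" where
  "tso_instance D e =
     \<lparr>num_vals = num_values, num_vars = 3, proc_list = D,
      target_list = [to_nat (Await 0 False), to_nat (Await 0 True)],
      init_locs = [to_nat (Await 1 False), to_nat (Writer [] False (par True (replicate e 1 @ [3])))],
      init_bufs = [[], rev (msgs True (replicate e 1 @ [3]))],
      init_mem = [2, 0, yv [] True]\<rparr>"

locale machine =
  fixes \<delta> :: "nat \<Rightarrow> nat \<Rightarrow> nat list \<times> nat" and N :: nat
  assumes bounds: "\<lbrakk>\<delta> q a = (w, q'); 0 < q; q < N; a \<in> {1, 2, 3}\<rbrakk> \<Longrightarrow> w \<in> words \<and> q' < N"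
    and N: "1 < N"
begin

definition "I e = tso_instance (procs_of \<delta> N) e"

abbreviation "P e \<equiv> input_program (I e)"

abbreviation "queue e \<equiv> replicate e 1 @ [3 :: nat]"

section \<open>Well-formedness of the instances\<close>

lemma program_simps:
  "procs (P e) = {0, 1}" "vals (P e) = {..<num_values}" "vars (P e) = {..<3}"
  by (auto simp: I_def tso_instance_def input_program_def procs_of_def)

lemma finite_instrs: "finite (instrs (P e))"
proof -
  have "instrs (P e) \<subseteq> case_prod Rd ` ({..<3} \<times> {..<num_values})
      \<union> case_prod Wr ` ({..<3} \<times> {..<num_values}) \<union> {Skip, Mf}"
    by (auto simp: instrs_def program_simps)
  then show ?thesis by (rule finite_subset) simp
qed

lemma controls_in:
  assumes "controls \<delta> N s a t"
  shows "s \<in> control_states N \<and> a \<in> instrs (P e) \<and> t \<in> control_states N"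
  using assms
proof cases
  case (1 q b w q' p)
  then show ?thesis using bounds[of q b w q']
    by (auto simp: instrs_def program_simps intro!: symbol_less)
qed (auto simp: instrs_def program_simps yv_less intro!: symbol_less)

lemma writes_in:
  assumes "writes s a t"
  shows "s \<in> writer_states \<and> a \<in> instrs (P e) \<and> t \<in> writer_states"
  using assms
proof cases
  case (3 b w p r)
  then show ?thesis using words_Cons[of b w]
    by (auto simp: instrs_def program_simps intro!: symbol_less)
qed (auto simp: instrs_def program_simps yv_less)

lemma finite_trans:
  "finite {(to_nat s, a, to_nat t) | s a t. controls \<delta> N s a t}"
  "finite {(to_nat s, a, to_nat t) | s a t. writes s a t}"
proof -
  show "finite {(to_nat s, a, to_nat t) | s a t. controls \<delta> N s a t}"
    by (rule finite_subset[of _ "to_nat ` control_states N \<times> instrs (P 0) \<times> to_nat ` control_states N"])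
      (use controls_in[where e = 0] in \<open>auto simp: finite_states finite_instrs\<close>)
  show "finite {(to_nat s, a, to_nat t) | s a t. writes s a t}"
    by (rule finite_subset[of _ "to_nat ` writer_states \<times> instrs (P 0) \<times> to_nat ` writer_states"])
      (use writes_in[where e = 0] in \<open>auto simp: finite_states finite_instrs\<close>)
qed

lemma states_program:
  "states (P e) 0 = to_nat ` control_states N" "states (P e) (Suc 0) = to_nat ` writer_states"
  by (simp_all add: I_def tso_instance_def input_program_def procs_of_def set_listing finite_states)

lemma trans_program:
  "trans (P e) 0 = {(to_nat s, a, to_nat t) | s a t. controls \<delta> N s a t}"
  "trans (P e) (Suc 0) = {(to_nat s, a, to_nat t) | s a t. writes s a t}"
  by (simp_all add: I_def tso_instance_def input_program_def procs_of_def set_listing finite_trans)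

lemma wf_P: "wf_program (P e)"
  unfolding wf_program_def
  using controls_in[where e = e] writes_in[where e = e]
  by (auto simp: program_simps states_program trans_program finite_states)

lemma init_view:
  "view (input_init (I e)) (Await 1 False) (Writer [] False (par True (queue e))) []
     (rev (msgs True (queue e))) (\<lambda>b. if b then 0 else 2) (yv [] True)"
  by (auto simp: view_def input_init_def I_def tso_instance_def procs_of_def xv_def)

lemma init_conf: "input_init (I e) \<in> tso_confs (P e)"
proof -
  have "valid (rev (msgs True (queue e))) (\<lambda>_. 0)" by (rule valid_msgs) auto
  then have "set (msgs True (queue e)) \<subseteq> range xv \<times> {1, 2, 3}"
    by (simp only: valid_def set_rev)
  also have "\<dots> \<subseteq> {..<3} \<times> {..<num_values}" by (auto intro!: symbol_less)
  finally have "set (msgs True (queue e)) \<subseteq> {..<3} \<times> {..<num_values}" .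
  then have bufs: "rev (msgs True (queue e)) \<in> lists ({..<3} \<times> {..<num_values})"
    by (simp only: lists_eq_set mem_Collect_eq set_rev)
  have small: "2 < num_values" "0 < num_values" by (auto intro: symbol_less)
  let ?c = "input_init (I e)"
  have ext: "loc ?c i = undefined" "buf ?c i = undefined" if "i \<noteq> 0" "i \<noteq> 1" for i
    using that by (simp_all add: input_init_def I_def tso_instance_def procs_of_def)
  have ext_mem: "mem ?c x = undefined" if "\<not> x < 3" for x
    using that by (simp add: input_init_def I_def tso_instance_def)
  have v: "loc ?c 0 = to_nat (Await 1 False)" "loc ?c 1 = to_nat (Writer [] False (par True (queue e)))"
    "buf ?c 0 = []" "buf ?c 1 = rev (msgs True (queue e))"
    "\<And>b. mem ?c (xv b) = (if b then 0 else 2)" "mem ?c 2 = yv [] True"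
    using init_view[of e] by (auto simp: view_def)
  have "mem ?c x < num_values" if "x < 3" for x
  proof -
    have "x = xv False \<or> x = xv True \<or> x = 2" using that by (auto simp: xv_def)
    then show ?thesis using v(5,6) small yv_less[OF Nil_words, of True] by (elim disjE) simp_all
  qed
  moreover have "loc ?c 0 \<in> states (P e) 0" "loc ?c 1 \<in> states (P e) 1"
    using N v(1,2) by (auto simp: states_program)
  ultimately show ?thesis
    unfolding tso_confs_def program_simps using bufs v(3,4) ext ext_mem
    by (auto simp: PiE_iff extensional_def simp del: rev_msgs_snoc)
qed

lemma targets_I: "input_targets (I e) = targets"
  by (auto simp: input_targets_def targets_def I_def tso_instance_def)

lemma wf_instance: "wf_input (I e)"
proof -
  have "ConfA (input_init (I e)) \<notin> confs_hitting (P e) (input_targets (I e))"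
    using init_view[of e]
    by (auto simp: confs_hitting_def program_simps view_def targets_I targets_def)
  moreover have "input_targets (I e) \<subseteq> local_states (P e)"
    using N by (auto simp: local_states_def program_simps states_program targets_I targets_def)
  ultimately show ?thesis using wf_P init_conf unfolding wf_input_def
    by (simp add: I_def tso_instance_def procs_of_def)
qed

sublocale gadget \<delta> N "P e" for e
  by unfold_locales (use bounds wf_P program_simps trans_program in auto)

lemma A_wins_iff:
  "A_wins_from (tso_game (P e)) (W_S (P e) (input_targets (I e)) \<inter> W_P (P e)) (ConfA (input_init (I e)))
   \<longleftrightarrow> \<not> (\<exists>u. qsteps \<delta> (1, blocks [e] @ [3]) (0, u))"
proof (cases "\<exists>u. qsteps \<delta> (1, blocks [e] @ [3]) (0, u)")
  case True
  then obtain k where k: "halts_in \<delta> k (1, 2 # queue e)" using qsteps_halts_in by fastforce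
  have "B_invariant \<delta> N (10 * k) (Await 1 False) (Writer [] False (par (\<not> False) (queue e))) []
    (rev (msgs (\<not> False) (queue e))) (\<lambda>b. if b then 0 else 2) (yv [] (\<not> False))"
    by (rule B_invariant.await) (use k N in auto)
  from update_player_wins[OF this _ init_conf] init_view show ?thesis
    unfolding targets_I using True by simp
next
  case False
  \<comment> \<open>The bounds on state and symbols are carried along because \<open>bounds\<close>
    controls the machine only within them.\<close>
  define reach where "reach c \<longleftrightarrow> qsteps \<delta> (1, blocks [e] @ [3]) c \<and> fst c < N \<and> set (snd c) \<subseteq> {1, 2, 3}" for c
  have pos: "0 < q" if "reach (q, u)" for q u
    using that False unfolding reach_def by (metis gr0I)
  interpret gadget_safe \<delta> N "P e" reach
  proof
    show "0 < q \<and> q < N" if "reach (q, u)" for q u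
      using pos[OF that] that by (simp add: reach_def)
    show "reach (q', u @ w)" if "reach (q, a # u)" "\<delta> q a = (w, q')" for q a u w q'
    proof -
      have "qstep \<delta> (q, a # u) (q', u @ w)"
        using qstep.intros[of q \<delta> a w q' u] that pos[OF that(1)] by simp
      then show ?thesis using that bounds[OF that(2) pos[OF that(1)]]
        by (auto simp: reach_def words_def)
    qed
  qed
  let ?f = "\<lambda>b. if b then 0 else 2 :: nat"
  have v: "valid (rev (msgs True (queue e))) ?f" by (rule valid_msgs) auto
  have c: "content ?f False (rev (msgs True (queue e))) (par True (queue e)) (2 # queue e)"
    by (simp add: content_def)
  have r: "reach (1, (2 # queue e) @ [])" using N by (auto simp: reach_def)
  have "A_invariant reach N (Await 1 False) (Writer [] False (par True (queue e))) []
    (rev (msgs True (queue e))) ?f (yv [] True)"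
    using A_invariant.read[where reach = reach and N = N, OF v c r Nil_words Nil_words] by simp
  from process_player_wins[OF init_view this init_conf] False show ?thesis
    unfolding targets_I by simp
qed

end

text \<open>The number \<open>d\<close> occurs in two roles, as the code of the process list and as
  the unary input in the initial buffer.\<close>

definition instance_code :: "nat \<Rightarrow> nat" where
  "instance_code d = list_encode [num_values, 3, d,
     list_encode [to_nat (Await 0 False), to_nat (Await 0 True)],
     list_encode [to_nat (Await 1 False), to_nat (Writer [] False (par True (replicate d 1 @ [3])))],
     list_encode [0, list_encode (map prod_encode (rev (msgs True (replicate d 1 @ [3]))))],
     list_encode [2, 0, yv [] True]]"

lemma encode_tso_instance:
  "encode_input (tso_instance D (list_encode (map encode_proc D))) =
     instance_code (list_encode (map encode_proc D))"
  by (simp add: encode_input_def tso_instance_def instance_code_def)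

section \<open>Computability of the instance number\<close>

lemma computable_list_encode_Cons:
  "computable k a \<Longrightarrow> computable k (\<lambda>xs. list_encode (l xs)) \<Longrightarrow> computable k (\<lambda>xs. list_encode (a xs # l xs))"
  by (simp add: computable_Suc computable_prod_encode)

lemma computable_instance_code: "computable 1 (\<lambda>xs. instance_code (xs ! 0))"
proof -
  note [simp del] = list_encode.simps
  let ?x = "\<lambda>n :: nat. if n mod 2 = 0 then 1 else 0 :: nat"
  have par: "par True (replicate n 1) \<longleftrightarrow> n mod 2 = 0" for n
    by (auto simp: par_def)
  have x: "computable k (\<lambda>xs. ?x (a xs))" if "computable k a" for k a
    by (rule computable_case[OF computable_parity[OF that]])
  \<comment> \<open>Reversal puts the newest message at the head, so each further unit adds one list
    cell in front, and the code of the buffer is a primitive recursion on \<open>n\<close>.\<close>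
  have u: "list_encode (map prod_encode (rev (msgs True (replicate n 1)))) =
    rec_nat 0 (\<lambda>m l. Suc (prod_encode (prod_encode (?x m, 1), l))) n" for n
  proof (induction n)
    case 0
    show ?case by (simp add: list_encode.simps)
  next
    case (Suc n)
    have "replicate (Suc n) 1 = replicate n 1 @ [1 :: nat]" by (simp add: replicate_append_same)
    then show ?case
      by (simp only: rev_msgs_snoc par list.map list_encode.simps Suc.IH nat.rec(2) xv_def of_bool_def)
  qed
  have "computable 1 (\<lambda>xs. rec_nat 0 (\<lambda>m l. Suc (prod_encode (prod_encode (?x m, 1), l))) (xs ! 0))"
    by (rule computable_rec) (intro computable_Suc computable_prod_encode x computable_const computable_nth; simp)
  then have units: "computable 1 (\<lambda>xs. list_encode (map prod_encode (rev (msgs True (replicate (xs ! 0) 1)))))"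
    unfolding u .
  have r: "par True (replicate n 1 @ [3]) \<longleftrightarrow> n mod 2 \<noteq> 0" for n
    unfolding par_simps(3) par ..
  have loc: "to_nat (Writer [] False (par True (replicate n 1 @ [3]))) =
    (if n mod 2 = 0 then to_nat (Writer [] False False) else to_nat (Writer [] False True))" for n
    unfolding r by simp
  show ?thesis
    unfolding instance_code_def loc rev_msgs_snoc list.map par xv_def of_bool_def
    by (intro computable_list_encode_Cons computable_const computable_prod_encode x
        computable_case computable_parity units computable_nth) simp_all
qed

theorem theorem4:
  shows "\<not> decidable_on {I. wf_input I} encode_input
           (\<lambda>I. A_wins_from (tso_game (input_program I))
                  (W_S (input_program I) (input_targets I) \<inter> W_P (input_program I))
                  (ConfA (input_init I)))"
proof
  let ?win = "\<lambda>I. A_wins_from (tso_game (input_program I))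
    (W_S (input_program I) (input_targets I) \<inter> W_P (input_program I)) (ConfA (input_init I))"
  assume "decidable_on {I. wf_input I} encode_input ?win"
  then obtain f where f: "\<And>I. wf_input I \<Longrightarrow> computes f [encode_input I] (if ?win I then 1 else 0)"
    unfolding decidable_on_def by blast
  obtain g where g: "\<And>xs. length xs = 1 \<Longrightarrow> computes g xs (instance_code (xs ! 0))"
    using computable_instance_code unfolding computable_def by blast
  have "computable 1 (\<lambda>xs. if xs ! 0 = 0 then 1 else 0)"
    by (intro computable_case computable_nth) simp
  then obtain h where h: "\<And>xs. length xs = 1 \<Longrightarrow> computes h xs (if xs ! 0 = 0 then 1 else 0)"
    unfolding computable_def by blast
  \<comment> \<open>\<open>c\<close> is built from \<open>f\<close>, \<open>g\<close> and
    \<open>h\<close> alone. The machine made from it receives the code of its own processes as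
    input, which closes the diagonal.\<close>
  define c where "c = compile (Comp h [Comp f [g]]) 1"
  define \<delta> where "\<delta> = code_step (halt_on_zero c) 1 0"
  define N where "N = 1 + code_size (halt_on_zero c)"
  interpret machine \<delta> N
  proof
    show "w \<in> words \<and> q' < N" if "\<delta> q a = (w, q')" "0 < q" "q < N" "a \<in> {1, 2, 3}" for q a w q'
      using code_step_bounds[of "halt_on_zero c" 1 0 q a w q'] that by (auto simp: \<delta>_def N_def words_def)
    show "1 < N" using code_size_pos[of "halt_on_zero c"] by (simp add: N_def)
  qed
  define d where "d = list_encode (map encode_proc (procs_of \<delta> N))"
  define y :: nat where "y = (if ?win (I d) then 0 else 1)"
  have "encode_input (I d) = instance_code d"
    unfolding I_def d_def by (rule encode_tso_instance)
  then have "computes f [instance_code d] (if ?win (I d) then 1 else 0)"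
    using f[OF wf_instance[of d]] by simp
  moreover have "computes g [d] (instance_code d)" using g[of "[d]"] by simp
  moreover have "computes h [if ?win (I d) then 1 else 0] y"
    using h[of "[if ?win (I d) then 1 else 0]"] by (simp add: y_def split: if_splits)
  ultimately have "computes (Comp h [Comp f [g]]) [d] y" by (blast intro: computes.comp)
  then have "exec c [d] (y # [])" using exec_compile[of _ "[d]" y "[]"] by (simp add: c_def del: compile.simps)
  from halt_on_zero_halts_iff[OF this, folded \<delta>_def] A_wins_iff[of d] show False
    by (auto simp: y_def split: if_splits)
qed

end
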